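(* Let $d\ge2$, $M>d-1$, and $m:=\lceil(M-d+2)/2\rceil$. For $\varepsilon\in(0,1]$ and $\eta\in\mathbb{S}^{d-1}$ put $a:=1+\varepsilon$ and define $$f_{\varepsilon,\eta}(x):=H_{\varepsilon,m}(a\eta,x)\Big(\int_{\mathbb{S}^{d-1}}H_{\varepsilon,m}(a\eta,y)\,d\sigma(y)\Big)^{-1},\quad x\in\mathbb{R}^d\setminus\{a\eta\},$$ where $H_{\varepsilon,m}$ is the function defined in the context. Then $f_{\varepsilon,\eta}$ solves the following problem. For each $\varepsilon\in(0,1]$ there are constants $b_0,\dots,b_m\in\mathbb{R}$ such that for all $\eta\in\mathbb{S}^{d-1}$ and $x\in\mathbb{R}^d\setminus\{a\eta\}$ $$f_{\varepsilon,\eta}(x)=\sum_{\ell=0}^m b_\ell(\eta\cdot\nabla)^\ell\Big(\frac{1}{|x-a\eta|^{d-2}}\Big)\ \text{ if }d>2,\qquad f_{\varepsilon,\eta}(x)=b_0+\sum_{\ell=1}^m b_\ell(\eta\cdot\nabla)^\ell\ln\frac{1}{|x-a\eta|}\ \text{ if }d=2,$$ and the restriction $F_\varepsilon(x\cdot\eta)$ of $f_{\varepsilon,\eta}$ to $\mathbb{S}^{d-1}$ satisfies $$|F_\varepsilon(x\cdot\eta)|\le\frac{c\,\varepsilon^{-d+1}}{(1+\varepsilon^{-1}\rho(x,\eta))^M}\quad\text{for all }x,\eta\in\mathbb{S}^{d-1},\qquad \int_{\mathbb{S}^{d-1}}F_\varepsilon(x\cdot\eta)\,d\sigma(x)=1\quad\text{for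 all }\eta\in\mathbb{S}^{d-1},$$ with a constant $c>0$ depending only on $M$ and $d$.
   Context: $|\cdot|$ is the Euclidean norm and $x\cdot y$ the dot product on $\mathbb{R}^d$; $\mathbb{S}^{d-1}$ is the unit sphere in $\mathbb{R}^d$; $\rho(x,\eta):=\arccos(x\cdot\eta)$ is the geodesic distance on $\mathbb{S}^{d-1}$; $\sigma$ is the Lebesgue (surface) measure on $\mathbb{S}^{d-1}$. $(\eta\cdot\nabla)^\ell$ is the $\ell$th directional derivative (in $x$) in direction $\eta$. $(u)_0:=1$, $(u)_k:=u(u+1)\cdots(u+k-1)$, and $(u)_+:=\max\{0,u\}$. For $m\in\mathbb{N}$, $d\ge2$, $0<\varepsilon\le1$, $\eta\in\mathbb{S}^{d-1}$, $a:=1+\varepsilon$, $\delta:=1-a^{-2}$, and $x\in\mathbb{R}^d\setminus\{a\eta\}$: $$H_{\varepsilon,m}(a\eta,x):=q_0|x-a\eta|^{2-d}+\sum_{\ell=1}^m\frac{q_\ell\,\delta^{\ell-1}a^\ell}{\ell!\,(d-2)}(\eta\cdot\nabla)^\ell|x-a\eta|^{2-d}\quad\text{if }d\ge3,$$ $$H_{\varepsilon,m}(a\eta,x):=q_0+\sum_{\ell=1}^m\frac{q_\ell\,\delta^{\ell-1}a^\ell}{\ell!}(\eta\cdot\nabla)^\ell\ln\frac{1}{|x-a\eta|}\quad\text{if }d=2,$$ where $q_0,\dots,q_m$ are determined as the solution of the (triangular) linear system $$q_0+\sum_{\ell=1}^m(d/2)_{\ell-1}\frac{\delta^{\ell-1}}{2\,\ell!}q_\ell=0,\qquad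 q_m=1,$$ $$\sum_{\ell=0}^{m-\nu}\Big[\sum_{k=(\ell-\nu)_+}^{\ell}(-1)^{\ell-k}\binom{\nu}{\ell-k}(d/2+\nu-1)_k\frac{\delta^k}{k!}\Big]q_{\nu+\ell}=0,\quad\nu=1,\dots,m-1.$$ *)

theory Defs
  imports "HOL-Analysis.Analysis"
begin

(* Surface measure of the unit sphere, obtained from Lebesgue measure by polar coordinates:
   the measure of A is d times the volume of the cone {r *\<^sub>R y | 0 < r < 1, y \<in> A}.
   It is not normalised: the whole sphere has measure d times the volume of the unit ball.
   The origin is removed so that sgn (x / norm x) maps into the sphere. *)
definition sphere_measure :: "(real ^ 'n) measure" where
  "sphere_measure =
     scale_measure (of_nat CARD('n))
       (distr (restrict_space lborel (ball 0 1 - {0})) (restrict_space borel (sphere 0 1)) sgn)"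

lemma space_sphere_measure [simp]: "space sphere_measure = sphere 0 1"
  by (simp add: sphere_measure_def space_scale_measure space_restrict_space)

lemma sets_sphere_measure [simp]:
  "sets sphere_measure = sets (restrict_space borel (sphere 0 1))"
  by (simp add: sphere_measure_def)

lemma emeasure_sphere_measure:
  fixes A :: "(real ^ 'n) set"
  assumes "A \<in> sets sphere_measure"
  shows "emeasure sphere_measure A =
           of_nat CARD('n) * emeasure lborel {x \<in> ball 0 1 - {0}. sgn x \<in> A}"
proof -
  let ?L = "restrict_space lborel (ball 0 1 - {0}) :: (real ^ 'n) measure"
  let ?S = "restrict_space borel (sphere 0 1) :: (real ^ 'n) measure"
  have "(sgn :: real ^ 'n \<Rightarrow> real ^ 'n) \<in> borel_measurable lborel"
    unfolding sgn_div_norm[abs_def] by measurable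
  then have "sgn \<in> borel_measurable ?L"
    by (rule measurable_restrict_space1)
  moreover have "sgn \<in> space ?L \<rightarrow> sphere 0 1"
    by (auto simp: space_restrict_space norm_sgn)
  ultimately have meas: "sgn \<in> measurable ?L ?S"
    by (intro measurable_restrict_space2)
  have A: "A \<in> sets ?S"
    using assms by simp
  have eq: "sgn -` A \<inter> space ?L = {x \<in> ball 0 1 - {0}. sgn x \<in> A}"
    by (auto simp: space_restrict_space)
  have "emeasure sphere_measure A = of_nat CARD('n) * emeasure ?L (sgn -` A \<inter> space ?L)"
    unfolding sphere_measure_def by (simp only: emeasure_scale_measure emeasure_distr[OF meas A])
  also have "emeasure ?L (sgn -` A \<inter> space ?L) =
      emeasure lborel {x \<in> ball 0 1 - {0}. sgn x \<in> A}"
    unfolding eq by (rule emeasure_restrict_space) auto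
  finally show ?thesis .
qed

definition geodesic_dist :: "real ^ 'n \<Rightarrow> real ^ 'n \<Rightarrow> real" where
  "geodesic_dist x \<eta> = arccos (x \<bullet> \<eta>)"

definition dir_deriv :: "real ^ 'n \<Rightarrow> (real ^ 'n \<Rightarrow> real) \<Rightarrow> real ^ 'n \<Rightarrow> real" where
  "dir_deriv \<eta> g x = deriv (\<lambda>t. g (x + t *\<^sub>R \<eta>)) 0"

(* The triangular linear system for q_0, ..., q_m. Since subtraction on nat truncates,
   the lower summation limit l - \<nu> is (l - \<nu>)_+. *)
definition coeff_system :: "nat \<Rightarrow> real \<Rightarrow> nat \<Rightarrow> (nat \<Rightarrow> real) \<Rightarrow> bool" where
  "coeff_system d \<delta> m q \<longleftrightarrow>
     q 0 + (\<Sum>l = 1..m. pochhammer (real d / 2) (l - 1) * (\<delta> ^ (l - 1) / (2 * fact l)) * q l) = 0 \<and>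
     q m = 1 \<and>
     (\<forall>\<nu> \<in> {1..m - 1}.
        (\<Sum>l = 0..m - \<nu>.
           (\<Sum>k = l - \<nu>..l. (-1) ^ (l - k) * real (\<nu> choose (l - k)) *
              pochhammer (real d / 2 + real \<nu> - 1) k * (\<delta> ^ k / fact k)) * q (\<nu> + l)) = 0)"

(* The indices above m do not occur in the system; the value 0 there makes the solution unique. *)
definition coeffs :: "nat \<Rightarrow> real \<Rightarrow> nat \<Rightarrow> nat \<Rightarrow> real" where
  "coeffs d \<delta> m = (THE q. coeff_system d \<delta> m q \<and> (\<forall>l > m. q l = 0))"

(* kernel_H \<epsilon> m \<eta> x is the function H_{\<epsilon>,m}(a\<eta>, x); its value at x = a\<eta> is irrelevant. *)
definition kernel_H :: "real \<Rightarrow> nat \<Rightarrow> real ^ 'n \<Rightarrow> real ^ 'n \<Rightarrow> real" where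
  "kernel_H \<epsilon> m \<eta> x =
     (let d = CARD('n); a = 1 + \<epsilon>; \<delta> = 1 - 1 / a\<^sup>2; q = coeffs d \<delta> m in
      if d = 2 then
        q 0 + (\<Sum>l = 1..m. q l * \<delta> ^ (l - 1) * a ^ l / fact l *
          (dir_deriv \<eta> ^^ l) (\<lambda>z. ln (1 / norm (z - a *\<^sub>R \<eta>))) x)
      else
        q 0 * norm (x - a *\<^sub>R \<eta>) powi (2 - int d) +
        (\<Sum>l = 1..m. q l * \<delta> ^ (l - 1) * a ^ l / (fact l * (real d - 2)) *
          (dir_deriv \<eta> ^^ l) (\<lambda>z. norm (z - a *\<^sub>R \<eta>) powi (2 - int d)) x))"

definition kernel_f :: "real \<Rightarrow> nat \<Rightarrow> real ^ 'n \<Rightarrow> real ^ 'n \<Rightarrow> real" where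
  "kernel_f \<epsilon> m \<eta> x = kernel_H \<epsilon> m \<eta> x * inverse (LINT y|sphere_measure. kernel_H \<epsilon> m \<eta> y)"

end

theory Submission
  imports Defs
begin

(* From here on the infix dollar sign denotes coefficients of formal power series. *)
unbundle no vec_syntax
unbundle fps_syntax

text \<open>
  Write \<open>d\<close> for the dimension, \<open>r = \<bar>x - a\<eta>\<bar>\<close> and \<open>\<kappa> = a\<delta> = a - 1/a\<close>. For \<open>\<bar>x\<bar> = 1\<close> the scalar product of
  \<open>x - a\<eta>\<close> and \<open>\<eta>\<close> is determined by \<open>r\<close>, and along the line through \<open>x\<close> in direction \<open>\<eta>\<close> one finds
  \<open>\<bar>x - a\<eta> + \<kappa>w\<eta>\<bar>\<^sup>2 = r\<^sup>2 (1 - \<delta>w - z w(1 - w))\<close> with \<open>z = \<kappa>\<^sup>2 / r\<^sup>2\<close>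
  (\<open>sphere_pole_geometry\<close>). Expanding the power \<open>(2 - d)/2\<close> of the right-hand side, or its logarithm
  if \<open>d = 2\<close>, in powers of \<open>w\<close> shows that for \<open>l \<ge> 1\<close> the \<open>l\<close>-th derivative of the Newtonian
  potential in direction \<open>\<eta>\<close> is, up to normalisation, \<open>r\<close> to the power \<open>2 - d\<close> times a polynomial of degree \<open>l\<close>
  in \<open>z\<close>. For \<open>\<nu> \<ge> 1\<close> its coefficient at \<open>z^\<nu>\<close> is a constant depending only on \<open>\<nu>\<close> and \<open>d\<close> times the
  coefficient of \<open>w^(l - \<nu>)\<close> in \<open>(1 - w)^\<nu> (1 - \<delta>w)^(1 - \<nu> - d/2)\<close>, and these numbers are the entries
  of the linear system for \<open>q\<close> (\<open>kernel_fps_nth\<close>, \<open>dir_deriv_newton_on_sphere\<close>). So the system says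
  that in \<open>H\<close> all powers of \<open>z\<close> cancel except \<open>z^m\<close> (\<open>coeff_system_collapse\<close>): on the sphere
  \<open>H = K / r^p\<close> with \<open>p = 2m + d - 2\<close> and a constant \<open>K > 0\<close> depending only on \<open>\<epsilon>\<close>, \<open>m\<close> and \<open>d\<close>
  (\<open>kernel_H_on_sphere\<close>).

  The rest is an estimate of \<open>1 / r^p\<close> divided by its integral \<open>J\<close> over the sphere. The surface
  measure is invariant under rotations, so \<open>J\<close> does not depend on \<open>\<eta>\<close> (\<open>zonal_integral_eq\<close>). On the
  cap of radius \<open>\<epsilon>\<close> about \<open>\<eta>\<close>, whose measure is at least a constant times \<open>\<epsilon>^(d - 1)\<close>, one has
  \<open>r \<le> 2\<epsilon>\<close>; this bounds \<open>J\<close> from below (\<open>pole_profile_integral_ge\<close>). Finally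
  \<open>r \<ge> (\<epsilon> + \<rho>) / 4\<close> (\<open>dist_pole_ge\<close>), and the choice of \<open>m\<close> gives \<open>p \<ge> M\<close>.
\<close>

section \<open>The generating series of the directional derivatives\<close>

text \<open>
  The binomial series of \<open>(1 - s w)^(-u)\<close> in the variable \<open>w\<close>.
\<close>
definition binom_fps :: "real \<Rightarrow> real \<Rightarrow> real fps" where
  "binom_fps u s = Abs_fps (\<lambda>k. pochhammer u k * s ^ k / fact k)"

text \<open>
  The series of \<open>((1 - s w)^(-\<mu>) - 1) / (2\<mu>)\<close>, continued to \<open>\<mu> = 0\<close> as \<open>- ln (1 - s w) / 2\<close>.
  With \<open>\<mu> = (d - 2) / 2\<close> this normalisation treats the dimension \<open>2\<close> and the higher dimensions alike.
\<close>
definition potential_fps :: "real \<Rightarrow> real \<Rightarrow> real fps" where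
  "potential_fps \<mu> s = Abs_fps (\<lambda>k. if k = 0 then 0 else pochhammer (\<mu> + 1) (k - 1) * s ^ k / (2 * fact k))"

text \<open>
  The linear factor \<open>1 - s w\<close>.
\<close>
definition linear_fps :: "real \<Rightarrow> real fps" where
  "linear_fps s = 1 - fps_const s * fps_X"

lemma linear_fps_nth_0 [simp]: "linear_fps s $ 0 = 1"
  by (simp add: linear_fps_def)

lemma linear_fps_mult_nth: "(linear_fps s * f) $ n = f $ n - (if n = 0 then 0 else s * f $ (n - 1))"
  by (cases n) (simp_all add: linear_fps_def ring_distribs mult.assoc)

lemma linear_fps_mult_binom_fps_Suc: "linear_fps s * binom_fps (u + 1) s = binom_fps u s"
proof (rule fps_ext)
  fix n
  show "(linear_fps s * binom_fps (u + 1) s) $ n = binom_fps u s $ n"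
  proof (cases n)
    case (Suc k)
    have "pochhammer u (Suc k) = u * pochhammer (u + 1) k"
      by (rule pochhammer_rec)
    moreover have "pochhammer (u + 1) (Suc k) = pochhammer (u + 1) k * (u + 1 + real k)"
      by (rule pochhammer_Suc)
    ultimately show ?thesis
      using Suc by (simp add: linear_fps_mult_nth binom_fps_def divide_simps) (simp add: algebra_simps)
  qed (simp add: linear_fps_mult_nth binom_fps_def)
qed

lemma binom_fps_mult_inverse_power:
  "binom_fps u s * inverse (linear_fps s) ^ \<nu> = binom_fps (u + real \<nu>) s"
proof (induction \<nu>)
  case (Suc \<nu>)
  have unit: "inverse (linear_fps s) * linear_fps s = 1"
    by (rule inverse_mult_eq_1) (simp add: linear_fps_def)
  have "binom_fps u s * inverse (linear_fps s) ^ Suc \<nu> = inverse (linear_fps s) * binom_fps (u + real \<nu>) s"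
    using Suc by (simp add: ac_simps)
  also have "\<dots> = inverse (linear_fps s) * linear_fps s * binom_fps (u + real (Suc \<nu>)) s"
    using linear_fps_mult_binom_fps_Suc[of s "u + real \<nu>"] by (simp add: ac_simps)
  finally show ?case
    by (simp add: unit)
qed simp

lemma binom_fps_eq_potential_fps: "binom_fps \<mu> s = 1 + fps_const (2 * \<mu>) * potential_fps \<mu> s"
proof (rule fps_ext)
  fix n
  show "binom_fps \<mu> s $ n = (1 + fps_const (2 * \<mu>) * potential_fps \<mu> s) $ n"
    by (cases n) (simp_all add: binom_fps_def potential_fps_def pochhammer_rec)
qed

lemma potential_fps_ODE: "linear_fps s * fps_deriv (potential_fps \<mu> s) = fps_const (s / 2) * binom_fps \<mu> s"
proof -
  have "fps_deriv (potential_fps \<mu> s) = fps_const (s / 2) * binom_fps (\<mu> + 1) s"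
    by (rule fps_ext) (simp add: binom_fps_def potential_fps_def divide_simps)
  then show ?thesis
    using linear_fps_mult_binom_fps_Suc[of s \<mu>] by (simp add: ac_simps)
qed

text \<open>
  The series \<open>y = z w (1 - w) / (1 - s w)\<close>, which factorises
  \<open>1 - s w - z w (1 - w) = (1 - s w) (1 - y)\<close>.
\<close>
definition radial_fps :: "real \<Rightarrow> real \<Rightarrow> real fps" where
  "radial_fps s z = fps_const z * fps_X * linear_fps 1 * inverse (linear_fps s)"

text \<open>
  The series of \<open>(Q^(-\<mu>) - 1) / (2\<mu>)\<close>, and of \<open>- ln Q / 2\<close> if \<open>\<mu> = 0\<close>, for the quadratic polynomial
  \<open>Q = 1 - s w - z w (1 - w)\<close>. It is written in terms of the factorisation of \<open>Q\<close>, so that its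
  coefficients can be read off as polynomials in \<open>z\<close>.
\<close>
definition kernel_fps :: "real \<Rightarrow> real \<Rightarrow> real \<Rightarrow> real fps" where
  "kernel_fps \<mu> s z = potential_fps \<mu> s + binom_fps \<mu> s * (potential_fps \<mu> 1 oo radial_fps s z)"

lemma radial_fps_nth_0 [simp]: "radial_fps s z $ 0 = 0"
  by (simp add: radial_fps_def mult.assoc)

lemma linear_fps_mult_radial_fps: "linear_fps s * radial_fps s z = fps_const z * fps_X * linear_fps 1"
proof -
  have unit: "inverse (linear_fps s) * linear_fps s = 1"
    by (rule inverse_mult_eq_1) (simp add: linear_fps_def)
  have "linear_fps s * radial_fps s z = inverse (linear_fps s) * linear_fps s * (fps_const z * fps_X * linear_fps 1)"
    by (simp add: radial_fps_def ac_simps)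
  then show ?thesis
    by (simp add: unit)
qed

text \<open>
  The quadratic polynomial \<open>1 - s w - z w (1 - w)\<close>.
\<close>
definition quadratic_fps :: "real \<Rightarrow> real \<Rightarrow> real fps" where
  "quadratic_fps s z = linear_fps s - fps_const z * fps_X * linear_fps 1"

text \<open>
  The differential equation \<open>Q L' = - Q' (1 + 2\<mu>L) / 2\<close> holds for every value of \<open>\<mu>\<close>, including \<open>0\<close>.
\<close>
lemma kernel_fps_ODE:
  "quadratic_fps s z * fps_deriv (kernel_fps \<mu> s z) =
    - fps_const (1/2) * fps_deriv (quadratic_fps s z) * (1 + fps_const (2 * \<mu>) * kernel_fps \<mu> s z)"
proof -
  define X where "X = radial_fps s z"
  define A where "A = potential_fps \<mu> s"
  define B where "B = binom_fps \<mu> s"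
  define P where "P = (potential_fps \<mu> 1 oo X)"
  define C where "C = (binom_fps \<mu> 1 oo X)"
  define P' where "P' = (fps_deriv (potential_fps \<mu> 1) oo X)"
  define h where "h = fps_const (1/2::real)"
  define l2 where "l2 = fps_const (2 * \<mu>)"
  define E where "E = linear_fps s"
  have X0: "X $ 0 = 0" by (simp add: X_def)
  have q: "quadratic_fps s z = E * (1 - X)"
    using linear_fps_mult_radial_fps[of s z] by (simp add: quadratic_fps_def X_def E_def right_diff_distrib)
  have dE: "fps_deriv E = - fps_const s"
    by (simp add: E_def linear_fps_def)
  have dP: "fps_deriv P = P' * fps_deriv X"
    unfolding P_def P'_def by (rule fps_compose_deriv[OF X0])
  have "linear_fps 1 * fps_deriv (potential_fps \<mu> 1) oo X = fps_const (1/2) * binom_fps \<mu> 1 oo X"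
    by (simp add: potential_fps_ODE)
  then have P': "(1 - X) * P' = h * C"
    by (simp add: fps_compose_mult_distrib[OF X0] C_def P'_def h_def linear_fps_def
        fps_compose_sub_distrib fps_X_fps_compose_startby0[OF X0])
  have C: "C = 1 + l2 * P"
    by (simp add: C_def P_def l2_def binom_fps_eq_potential_fps fps_compose_add_distrib
        fps_compose_mult_distrib[OF X0])
  have B: "B = 1 + l2 * A"
    by (simp add: B_def A_def l2_def binom_fps_eq_potential_fps)
  have EA: "E * fps_deriv A = h * fps_const s * B"
    by (simp add: E_def A_def B_def potential_fps_ODE h_def)
  have L: "kernel_fps \<mu> s z = A + B * P"
    by (simp add: kernel_fps_def A_def B_def P_def X_def)
  have dB: "fps_deriv B = l2 * fps_deriv A"
    by (simp add: B l2_def)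
  have dL: "fps_deriv (kernel_fps \<mu> s z) = fps_deriv A * C + B * (P' * fps_deriv X)"
    unfolding L by (simp add: dB dP C algebra_simps)
  have S: "1 + l2 * kernel_fps \<mu> s z = B * C"
    unfolding L B C by (simp add: algebra_simps)
  have "quadratic_fps s z * fps_deriv (kernel_fps \<mu> s z) =
      (1 - X) * C * (E * fps_deriv A) + E * B * fps_deriv X * ((1 - X) * P')"
    unfolding q dL by (simp add: algebra_simps)
  also have "\<dots> = h * (B * C) * (fps_const s * (1 - X) + E * fps_deriv X)"
    unfolding EA P' by (simp add: algebra_simps)
  also have "fps_const s * (1 - X) + E * fps_deriv X = - fps_deriv (quadratic_fps s z)"
    unfolding q by (simp add: dE algebra_simps del: fps_const_neg)
  also have "h * (B * C) * - fps_deriv (quadratic_fps s z) =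
      - h * fps_deriv (quadratic_fps s z) * (1 + l2 * kernel_fps \<mu> s z)"
    unfolding S by (simp add: algebra_simps)
  finally show ?thesis
    unfolding h_def l2_def .
qed

text \<open>
  The coefficients of the differential equation, compared at \<open>w^n\<close>. Up to scaling, the
  Taylor coefficients of the potential along a line satisfy the same three-term recurrence.
\<close>
lemma kernel_fps_recurrence:
  "real (n + 1) * kernel_fps \<mu> s z $ (n + 1) =
     (\<mu> + real n) * (z + s) * kernel_fps \<mu> s z $ n
     - (if n = 0 then 0 else (real n - 1 + 2 * \<mu>) * z * kernel_fps \<mu> s z $ (n - 1))
     + (if n = 0 then (z + s) / 2 else if n = 1 then - z else 0)"
proof -
  define L where "L = kernel_fps \<mu> s z"
  have q: "quadratic_fps s z = 1 - fps_const (z + s) * fps_X + fps_const z * fps_X ^ 2"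
    by (simp add: quadratic_fps_def linear_fps_def algebra_simps power2_eq_square flip: fps_const_add)
  have lhs: "quadratic_fps s z * fps_deriv L =
      fps_deriv L - fps_const (z + s) * (fps_X * fps_deriv L)
      + fps_const z * (fps_X ^ 2 * fps_deriv L)"
    by (simp add: q algebra_simps)
  have rhs: "- fps_const (1/2) * fps_deriv (quadratic_fps s z) * (1 + fps_const (2 * \<mu>) * L) =
      fps_const ((z + s) / 2) + fps_const (\<mu> * (z + s)) * L
      - fps_const z * fps_X - fps_const (2 * \<mu> * z) * (fps_X * L)"
  proof -
    have dq: "fps_deriv (quadratic_fps s z) = - fps_const (z + s) + fps_const (2 * z) * fps_X"
      by (simp add: q power2_eq_square algebra_simps flip: fps_const_add)
    define a b c l where abcl: "a = fps_const (1/2::real)" "b = fps_const (z + s)"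
      "c = fps_const (2 * z)" "l = fps_const (2 * \<mu>)"
    have ab: "a * b = fps_const ((z + s) / 2)" and ac: "a * c = fps_const z"
      and abl: "a * b * l = fps_const (\<mu> * (z + s))" and acl: "a * c * l = fps_const (2 * \<mu> * z)"
      by (simp_all add: abcl mult_ac)
    have "- a * fps_deriv (quadratic_fps s z) * (1 + l * L) =
        a * b + (a * b * l) * L - (a * c) * fps_X - (a * c * l) * (fps_X * L)"
      unfolding dq abcl(2,3)[symmetric] by (simp add: algebra_simps)
    then show ?thesis
      unfolding acl abl unfolding ab ac unfolding abcl .
  qed
  have eq: "fps_deriv L - fps_const (z + s) * (fps_X * fps_deriv L)
      + fps_const z * (fps_X ^ 2 * fps_deriv L) =
      fps_const ((z + s) / 2) + fps_const (\<mu> * (z + s)) * L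
      - fps_const z * fps_X - fps_const (2 * \<mu> * z) * (fps_X * L)"
    unfolding lhs[symmetric] rhs[symmetric] by (simp only: L_def kernel_fps_ODE)
  have X2: "(fps_X ^ 2 * fps_deriv L) $ k = (if k < 2 then 0 else real (k - 1) * L $ (k - 1))" for k
    unfolding fps_X_power_mult_nth by (auto simp: not_less le_iff_add)
  have "real (n + 1) * L $ (n + 1) - (z + s) * (if n = 0 then 0 else real n * L $ n)
      + z * (if n < 2 then 0 else real (n - 1) * L $ (n - 1)) =
      (if n = 0 then (z + s) / 2 else 0) + \<mu> * (z + s) * L $ n
      - (if n = 1 then z else 0) - 2 * \<mu> * z * (if n = 0 then 0 else L $ (n - 1))"
    using arg_cong[OF eq, of "\<lambda>f. f $ n"]
    by (cases n) (auto simp: X2)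
  moreover have "real (n - 1) = real n - 1" if "n \<noteq> 0"
    using that by simp
  ultimately show ?thesis
    unfolding L_def[symmetric] by (cases "n < 2") (auto simp: algebra_simps less_2_cases_iff)
qed

lemma fps_mult_compose_nth:
  fixes F G H :: "'a :: comm_ring_1 fps"
  assumes "H $ 0 = 0"
  shows "(F * (G oo H)) $ n = (\<Sum>\<nu>\<le>n. G $ \<nu> * (F * H ^ \<nu>) $ n)"
proof -
  have zero: "H ^ \<nu> $ i = 0" if "i < \<nu>" for i \<nu>
    using startsby_zero_power_prefix[of H, OF assms] that by blast
  have "(F * (G oo H)) $ n = (\<Sum>i=0..n. F $ i * (\<Sum>\<nu>=0..n - i. G $ \<nu> * H ^ \<nu> $ (n - i)))"
    by (simp add: fps_mult_nth fps_compose_nth)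
  also have "\<dots> = (\<Sum>i=0..n. F $ i * (\<Sum>\<nu>=0..n. G $ \<nu> * H ^ \<nu> $ (n - i)))"
    by (intro sum.cong arg_cong2[of _ _ _ _ "(*)"] sum.mono_neutral_left refl) (auto simp: zero)
  also have "\<dots> = (\<Sum>\<nu>=0..n. G $ \<nu> * (F * H ^ \<nu>) $ n)"
    unfolding sum_distrib_left fps_mult_nth by (subst sum.swap) (simp add: mult_ac)
  finally show ?thesis
    by (simp add: atMost_atLeast0)
qed

lemma linear_fps_one_power_nth: "linear_fps 1 ^ \<nu> $ i = (-1) ^ i * real (\<nu> choose i)"
proof (induction \<nu> arbitrary: i)
  case 0
  then show ?case by (cases i) auto
next
  case (Suc \<nu>)
  then show ?case
    by (cases i) (simp_all add: linear_fps_mult_nth algebra_simps)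
qed

text \<open>
  The coefficient of \<open>w^l\<close> in \<open>(1 - w)^\<nu> (1 - s w)^(-\<mu> - \<nu>)\<close>. For \<open>\<mu> = d/2 - 1\<close> and \<open>s = \<delta>\<close> it is the
  entry with row index \<open>\<nu> \<ge> 1\<close> and column index \<open>\<nu> + l\<close> of the linear system for \<open>q\<close>.
\<close>
definition system_entry :: "real \<Rightarrow> real \<Rightarrow> nat \<Rightarrow> nat \<Rightarrow> real" where
  "system_entry \<mu> s \<nu> l = (\<Sum>k = l - \<nu>..l. (-1) ^ (l - k) * real (\<nu> choose (l - k)) *
     pochhammer (\<mu> + real \<nu>) k * (s ^ k / fact k))"

lemma binom_fps_mult_linear_fps_power_nth:
  "(binom_fps (\<mu> + real \<nu>) s * linear_fps 1 ^ \<nu>) $ l = system_entry \<mu> s \<nu> l"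
proof -
  have "(binom_fps (\<mu> + real \<nu>) s * linear_fps 1 ^ \<nu>) $ l =
      (\<Sum>k=0..l. (-1) ^ (l - k) * real (\<nu> choose (l - k)) *
         pochhammer (\<mu> + real \<nu>) k * (s ^ k / fact k))"
    unfolding fps_mult_nth binom_fps_def linear_fps_one_power_nth
    by (intro sum.cong) (simp_all add: mult_ac)
  also have "\<dots> = system_entry \<mu> s \<nu> l"
    unfolding system_entry_def by (intro sum.mono_neutral_right) auto
  finally show ?thesis .
qed

lemma kernel_fps_nth:
  "kernel_fps \<mu> s z $ n = potential_fps \<mu> s $ n +
     (\<Sum>\<nu>=1..n. potential_fps \<mu> 1 $ \<nu> * z ^ \<nu> * system_entry \<mu> s \<nu> (n - \<nu>))"
proof -
  have summand: "(binom_fps \<mu> s * radial_fps s z ^ \<nu>) $ n = z ^ \<nu> * system_entry \<mu> s \<nu> (n - \<nu>)" if "\<nu> \<le> n" for \<nu>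
  proof -
    have "binom_fps \<mu> s * radial_fps s z ^ \<nu> =
        fps_const (z ^ \<nu>) * (fps_X ^ \<nu> * ((binom_fps \<mu> s * inverse (linear_fps s) ^ \<nu>) * linear_fps 1 ^ \<nu>))"
      by (simp add: radial_fps_def power_mult_distrib ac_simps fps_const_power)
    also have "\<dots> = fps_const (z ^ \<nu>) * (fps_X ^ \<nu> * (binom_fps (\<mu> + real \<nu>) s * linear_fps 1 ^ \<nu>))"
      by (simp only: binom_fps_mult_inverse_power)
    finally show ?thesis
      using that by (simp add: fps_X_power_mult_nth binom_fps_mult_linear_fps_power_nth)
  qed
  have "(binom_fps \<mu> s * (potential_fps \<mu> 1 oo radial_fps s z)) $ n =
      (\<Sum>\<nu>\<le>n. potential_fps \<mu> 1 $ \<nu> * (binom_fps \<mu> s * radial_fps s z ^ \<nu>) $ n)"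
    by (rule fps_mult_compose_nth) simp
  also have "\<dots> = (\<Sum>\<nu>\<le>n. potential_fps \<mu> 1 $ \<nu> * z ^ \<nu> * system_entry \<mu> s \<nu> (n - \<nu>))"
    by (intro sum.cong) (auto simp: summand)
  also have "\<dots> = (\<Sum>\<nu>=1..n. potential_fps \<mu> 1 $ \<nu> * z ^ \<nu> * system_entry \<mu> s \<nu> (n - \<nu>))"
    by (intro sum.mono_neutral_right) (auto simp: potential_fps_def)
  finally show ?thesis
    by (simp add: kernel_fps_def)
qed

section \<open>Higher derivatives of powers and logarithms of quadratic polynomials\<close>

lemma higher_deriv_eq_on_open:
  fixes h :: "nat \<Rightarrow> real \<Rightarrow> real"
  assumes "open U"
    and "\<And>n t. t \<in> U \<Longrightarrow> (h n has_real_derivative h (Suc n) t) (at t)"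
    and "t \<in> U"
  shows "(deriv ^^ n) (h 0) t = h n t"
  using \<open>t \<in> U\<close>
proof (induction n arbitrary: t)
  case (Suc n)
  have "((deriv ^^ n) (h 0) has_real_derivative h (Suc n) t) (at t)"
    using assms(2)[OF Suc.prems] \<open>open U\<close> Suc.prems
    by (rule has_field_derivative_transform_within_open) (simp add: Suc.IH)
  then show ?case
    by (simp add: DERIV_imp_deriv)
qed simp

text \<open>
  The successive derivatives of a solution \<open>G\<close> of \<open>Q G' = - Q' (\<mu>G + C)\<close>, where \<open>Q\<close> is a monic
  quadratic polynomial: the recursion is the \<open>(n + 1)\<close>-st derivative of this equation, solved for the
  highest derivative of \<open>G\<close>.
\<close>
fun quad_derivs :: "real \<Rightarrow> real \<Rightarrow> (real \<Rightarrow> real) \<Rightarrow> (real \<Rightarrow> real) \<Rightarrow> (real \<Rightarrow> real) \<Rightarrow>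
    nat \<Rightarrow> real \<Rightarrow> real" where
  "quad_derivs \<mu> C Q Q' G 0 t = G t"
| "quad_derivs \<mu> C Q Q' G (Suc 0) t = - Q' t * (\<mu> * G t + C) / Q t"
| "quad_derivs \<mu> C Q Q' G (Suc (Suc n)) t =
     - ((\<mu> + real (n + 1)) * Q' t * quad_derivs \<mu> C Q Q' G (Suc n) t
        + (real (n + 1) * (real n + 2 * \<mu>) * quad_derivs \<mu> C Q Q' G n t
           + (if n = 0 then 2 * C else 0))) / Q t"

text \<open>
  A sequence with the recurrence that the equation forces on Taylor coefficients at \<open>0\<close> is the
  sequence of Taylor coefficients. The power \<open>Q^(-\<mu>)\<close> satisfies the equation with \<open>C = 0\<close>, the function
  \<open>- ln Q / 2\<close> satisfies it with \<open>\<mu> = 0\<close> and \<open>C = 1/2\<close>.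
\<close>
lemma higher_deriv_quadratic_ODE:
  fixes G :: "real \<Rightarrow> real" and q0 q1 :: real and a :: "nat \<Rightarrow> real"
  defines "Q \<equiv> \<lambda>t. q0 + q1 * t + t\<^sup>2" and "Q' \<equiv> \<lambda>t. q1 + 2 * t"
  assumes U: "open U" "0 \<in> U" and pos: "\<And>t. t \<in> U \<Longrightarrow> Q t \<noteq> 0"
    and ODE: "\<And>t. t \<in> U \<Longrightarrow>
      (G has_real_derivative - Q' t * (\<mu> * G t + C) / Q t) (at t)"
    and a0: "a 0 = G 0"
    and rec: "\<And>n. q0 * (real (n + 1) * a (n + 1)) =
      - (\<mu> + real n) * q1 * a n - (if n = 0 then 0 else (real n - 1 + 2 * \<mu>) * a (n - 1))
      - (if n = 0 then q1 * C else if n = 1 then 2 * C else 0)"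
  shows "(deriv ^^ n) G 0 = fact n * a n"
proof -
  define h where "h = quad_derivs \<mu> C Q Q' G"
  have h0: "h 0 = G" and h1: "h (Suc 0) = (\<lambda>t. - Q' t * (\<mu> * G t + C) / Q t)"
    by (simp_all add: h_def fun_eq_iff)
  have hSS: "h (Suc (Suc n)) t = - ((\<mu> + real (n + 1)) * Q' t * h (Suc n) t
      + (real (n + 1) * (real n + 2 * \<mu>) * h n t + (if n = 0 then 2 * C else 0))) / Q t" for n t
    by (simp add: h_def)
  have dQ: "(Q has_real_derivative Q' t) (at t)" for t
    unfolding Q_def Q'_def by (auto intro!: derivative_eq_intros)
  have dQ': "(Q' has_real_derivative 2) (at t)" for t
    unfolding Q'_def by (auto intro!: derivative_eq_intros)
  have dh: "\<forall>t\<in>U. (h n has_real_derivative h (Suc n) t) (at t)" for n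
  proof (induction n rule: less_induct)
    case (less n)
    show ?case
    proof
      fix t assume t: "t \<in> U"
      note Q0 = pos[OF t]
      consider "n = 0" | "n = 1" | k where "n = Suc (Suc k)"
        by (metis One_nat_def old.nat.exhaust)
      then show "(h n has_real_derivative h (Suc n) t) (at t)"
      proof cases
        case 1
        then show ?thesis using ODE[OF t] by (simp add: h0 h1)
      next
        case 2
        have dG: "(G has_real_derivative h 1 t) (at t)"
          using ODE[OF t] by (simp add: h1)
        define N where "N = (\<lambda>t. - Q' t * (\<mu> * G t + C))"
        have dN: "(N has_real_derivative - 2 * (\<mu> * G t + C) - Q' t * (\<mu> * h 1 t)) (at t)"
          unfolding N_def by (auto intro!: derivative_eq_intros dG dQ')
        have hN: "h 1 = (\<lambda>t. N t / Q t)"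
          by (simp add: h1 N_def)
        have "(h 1 has_real_derivative
            ((- 2 * (\<mu> * G t + C) - Q' t * (\<mu> * h 1 t)) * Q t - N t * Q' t)
            / (Q t * Q t)) (at t)"
          using DERIV_divide[OF dN dQ Q0] by (simp only: hN[symmetric])
        also have "N t = h 1 t * Q t"
          unfolding hN using Q0 by simp
        also have "((- 2 * (\<mu> * G t + C) - Q' t * (\<mu> * h 1 t)) * Q t - h 1 t * Q t * Q' t)
            / (Q t * Q t) = h (Suc 1) t"
          using Q0 by (simp add: hSS h0 field_simps)
        finally show ?thesis using 2 by simp
      next
        case 3
        define e where "e = (if k = 0 then 2 * C else 0)"
        define w where "w = \<mu> + real (k + 1)"
        define v where "v = real (k + 1) * (real k + 2 * \<mu>)"
        have d1: "(h (Suc k) has_real_derivative h n t) (at t)"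
          using less.IH[of "Suc k"] 3 t by simp
        have d0: "(h k has_real_derivative h (Suc k) t) (at t)"
          using less.IH[of k] 3 t by simp
        define N where "N = (\<lambda>t. - (w * Q' t * h (Suc k) t + (v * h k t + e)))"
        have dN: "(N has_real_derivative - (w * (2 * h (Suc k) t + Q' t * h n t) + v * h (Suc k) t)) (at t)"
          unfolding N_def
          by (auto intro!: derivative_eq_intros d1 d0 dQ') (simp add: algebra_simps)
        have hN: "h n = (\<lambda>t. N t / Q t)"
          using 3 hSS[of k] by (simp add: fun_eq_iff N_def e_def w_def v_def)
        have "(h n has_real_derivative
            ((- (w * (2 * h (Suc k) t + Q' t * h n t) + v * h (Suc k) t)) * Q t - N t * Q' t)
            / (Q t * Q t)) (at t)"
          using DERIV_divide[OF dN dQ Q0] by (simp only: hN[symmetric])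
        also have "N t = h n t * Q t"
          using Q0 by (simp add: hN)
        also have "((- (w * (2 * h (Suc k) t + Q' t * h n t) + v * h (Suc k) t)) * Q t - h n t * Q t * Q' t)
            / (Q t * Q t) = h (Suc n) t"
        proof -
          have hSn: "h (Suc n) t = - ((w + 1) * Q' t * h n t + (v + 2 * w) * h (Suc k) t) / Q t"
            unfolding 3 hSS[of "Suc k"] by (simp add: w_def v_def algebra_simps)
          show ?thesis
            unfolding hSn using Q0 by (simp add: field_simps)
        qed
        finally show ?thesis .
      qed
    qed
  qed
  have "h n 0 = fact n * a n" for n
  proof (induction n rule: less_induct)
    case (less n)
    have Q0: "Q 0 = q0" "Q' 0 = q1" "q0 \<noteq> 0"
      using pos[OF U(2)] by (simp_all add: Q_def Q'_def)
    consider "n = 0" | "n = 1" | k where "n = Suc (Suc k)"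
      by (metis One_nat_def old.nat.exhaust)
    then show ?case
    proof cases
      case 1
      then show ?thesis by (simp add: h0 a0)
    next
      case 2
      have "q0 * a 1 = - q1 * (\<mu> * G 0 + C)"
        using rec[of 0] by (simp add: a0 algebra_simps)
      then show ?thesis
        using 2 Q0 by (simp add: h1 field_simps)
    next
      case 3
      have e: "(fact (Suc k) :: real) = real (k + 1) * fact k"
        "(fact n :: real) = real (k + 2) * (real (k + 1) * fact k)"
        using 3 by simp_all
      have "fact n * (q0 * a n) = real (k + 1) * fact k * (q0 * (real (Suc k + 1) * a (Suc k + 1)))"
        using 3 by (simp add: e)
      also have "\<dots> = - ((\<mu> + real (k + 1)) * q1 * (fact (Suc k) * a (Suc k))
          + (real (k + 1) * (real k + 2 * \<mu>) * (fact k * a k) + (if k = 0 then 2 * C else 0)))"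
        unfolding rec e(1) by (simp add: algebra_simps)
      also have "\<dots> = h n 0 * q0"
        using 3 Q0 less.IH[of k] less.IH[of "Suc k"] by (simp only: hSS) simp
      finally show ?thesis
        using Q0 by (simp add: ac_simps)
    qed
  qed
  then show ?thesis
    using higher_deriv_eq_on_open[of U h 0 n] U dh by (simp add: h0)
qed

section \<open>Distances to a pole along lines\<close>

text \<open>
  No differentiability is needed: both sides unfold to the same iteration of \<open>deriv\<close>, which is total.
\<close>
lemma funpow_dir_deriv:
  "(dir_deriv \<eta> ^^ n) g (x + t *\<^sub>R \<eta>) = (deriv ^^ n) (\<lambda>u. g (x + u *\<^sub>R \<eta>)) t"
proof (induction n arbitrary: t)
  case (Suc n)
  have "(dir_deriv \<eta> ^^ Suc n) g (x + t *\<^sub>R \<eta>) =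
      deriv (\<lambda>u. (dir_deriv \<eta> ^^ n) g (x + (t + u) *\<^sub>R \<eta>)) 0"
    by (simp add: dir_deriv_def scaleR_add_left add.assoc)
  also have "\<dots> = deriv ((deriv ^^ n) (\<lambda>u. g (x + u *\<^sub>R \<eta>)) \<circ> (+) t) 0"
    by (simp add: Suc.IH o_def)
  also have "\<dots> = (deriv ^^ Suc n) (\<lambda>u. g (x + u *\<^sub>R \<eta>)) t"
    by (simp add: deriv_shift_0 [symmetric])
  finally show ?case .
qed simp

text \<open>
  The scaling \<open>t = \<kappa>w\<close> turns the monic polynomial \<open>q0 + q1 t + t\<^sup>2\<close> into
  \<open>q0 (1 - s w - z w (1 - w))\<close> with \<open>z = \<kappa>\<^sup>2 / q0\<close>; this is what the hypothesis on \<open>q1\<close> says.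
\<close>
lemma Taylor_coeff_kernel_fps:
  fixes G :: "real \<Rightarrow> real"
  assumes pos: "\<And>t. t \<in> U \<Longrightarrow> q0 + q1 * t + t\<^sup>2 \<noteq> 0" and U: "open U" "0 \<in> U"
    and ODE: "\<And>t. t \<in> U \<Longrightarrow> (G has_real_derivative
      - (q1 + 2 * t) * (\<mu> * G t + C) / (q0 + q1 * t + t\<^sup>2)) (at t)"
    and q1: "\<kappa> * q1 = - (\<kappa>\<^sup>2 + s * q0)" and \<kappa>: "\<kappa> \<noteq> 0" and n: "n \<ge> 1"
  shows "\<kappa> ^ n / fact n * (deriv ^^ n) G 0 =
    2 * (\<mu> * G 0 + C) * kernel_fps \<mu> s (\<kappa>\<^sup>2 / q0) $ n"
proof -
  define z where "z = \<kappa>\<^sup>2 / q0"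
  define L where "L n = kernel_fps \<mu> s z $ n" for n
  define \<beta> where "\<beta> = 2 * (\<mu> * G 0 + C)"
  define a where "a n = (if n = 0 then G 0 else \<beta> * L n / \<kappa> ^ n)" for n
  have a0: "a 0 = G 0"
    by (simp add: a_def)
  have q0: "q0 \<noteq> 0"
    using pos[OF U(2)] by simp
  have z: "q0 * z = \<kappa>\<^sup>2"
    using q0 by (simp add: z_def)
  then have zs: "q0 * (z + s) = - \<kappa> * q1"
    using q1 by (simp add: algebra_simps)
  have L0: "L 0 = 0"
    by (simp add: L_def kernel_fps_def potential_fps_def)
  have rec: "q0 * (real (n + 1) * L (n + 1)) =
     - (\<mu> + real n) * \<kappa> * q1 * L n
     - (if n = 0 then 0 else (real n - 1 + 2 * \<mu>) * \<kappa>\<^sup>2 * L (n - 1))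
     + (if n = 0 then - \<kappa> * q1 / 2 else if n = 1 then - \<kappa>\<^sup>2 else 0)" for n
  proof -
    have "q0 * (real (n + 1) * L (n + 1)) =
     (\<mu> + real n) * (q0 * (z + s)) * L n
     - (if n = 0 then 0 else (real n - 1 + 2 * \<mu>) * (q0 * z) * L (n - 1))
     + (if n = 0 then q0 * (z + s) / 2 else if n = 1 then - (q0 * z) else 0)"
      unfolding L_def kernel_fps_recurrence by (simp add: algebra_simps)
    then show ?thesis
      unfolding zs z by (simp add: algebra_simps)
  qed
  have "(deriv ^^ n) G 0 = fact n * a n"
  proof (rule higher_deriv_quadratic_ODE[where U = U and \<mu> = \<mu> and C = C and ?q0.0 = q0 and ?q1.0 = q1])
    fix k
    show "q0 * (real (k + 1) * a (k + 1)) =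
      - (\<mu> + real k) * q1 * a k - (if k = 0 then 0 else (real k - 1 + 2 * \<mu>) * a (k - 1))
      - (if k = 0 then q1 * C else if k = 1 then 2 * C else 0)"
    proof (cases "k \<le> 1")
      case True
      then consider "k = 0" | "k = 1" by linarith
      then show ?thesis
      proof cases
        case 1
        have "q0 * (real (0 + 1) * a (0 + 1)) = \<beta> / \<kappa> * (q0 * (real (0 + 1) * L (0 + 1)))"
          by (simp add: a_def)
        also have "\<dots> = - \<beta> / 2 * q1"
          unfolding rec using \<kappa> by (simp add: L0)
        also have "\<dots> = - \<mu> * q1 * G 0 - q1 * C"
          by (simp add: \<beta>_def field_simps)
        finally show ?thesis
          using 1 a0 by simp
      next
        case 2
        have "q0 * (real (1 + 1) * a (1 + 1)) = \<beta> / \<kappa>\<^sup>2 * (q0 * (real (1 + 1) * L (1 + 1)))"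
          by (simp add: a_def power2_eq_square)
        also have "\<dots> = - (\<mu> + 1) * q1 * (\<beta> * L 1 / \<kappa>) - \<beta>"
          unfolding rec using \<kappa> by (simp add: L0 field_simps power2_eq_square)
        finally show ?thesis
          using 2 by (simp add: a_def \<beta>_def algebra_simps)
      qed
    next
      case False
      define j where "j = k - 1"
      have k: "k = j + 1" "j \<noteq> 0"
        using False by (simp_all add: j_def)
      have "q0 * (real (k + 1) * a (k + 1)) = \<beta> / \<kappa> ^ (k + 1) * (q0 * (real (k + 1) * L (k + 1)))"
        by (simp add: a_def)
      also have "\<dots> = - (\<mu> + real k) * q1 * (\<beta> * L k / \<kappa> ^ k)
          - (real k - 1 + 2 * \<mu>) * (\<beta> * L j / \<kappa> ^ j)"
        unfolding rec using \<kappa> k by (simp add: field_simps power2_eq_square)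
      finally show ?thesis
        using k by (simp add: a_def)
    qed
  qed (use U pos ODE in \<open>auto simp: a_def\<close>)
  then show ?thesis
    using n \<kappa> by (simp add: a_def L_def \<beta>_def z_def)
qed

text \<open>
  The second equation is the only place where the sphere enters into the shape of the kernel: with
  \<open>\<kappa> = a - 1/a\<close> it expresses the slope of the squared distance to the pole \<open>a\<eta>\<close> by the distance.
\<close>
lemma sphere_pole_geometry:
  fixes x \<eta> :: "'a :: real_inner"
  assumes "norm x = 1" "norm \<eta> = 1" "a \<noteq> 0"
  shows "(norm (x - a *\<^sub>R \<eta>))\<^sup>2 = 1 - 2 * a * (x \<bullet> \<eta>) + a\<^sup>2"
    and "(a * (1 - 1 / a\<^sup>2)) * (2 * ((x - a *\<^sub>R \<eta>) \<bullet> \<eta>)) =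
      - ((a * (1 - 1 / a\<^sup>2))\<^sup>2 + (1 - 1 / a\<^sup>2) * (norm (x - a *\<^sub>R \<eta>))\<^sup>2)"
proof -
  have 1: "x \<bullet> x = 1" "\<eta> \<bullet> \<eta> = 1"
    using assms by (simp_all add: dot_square_norm)
  show r: "(norm (x - a *\<^sub>R \<eta>))\<^sup>2 = 1 - 2 * a * (x \<bullet> \<eta>) + a\<^sup>2"
    unfolding power2_norm_eq_inner
    by (simp add: inner_diff_left inner_diff_right 1 inner_commute[of \<eta> x] power2_eq_square
        algebra_simps)
  show "(a * (1 - 1 / a\<^sup>2)) * (2 * ((x - a *\<^sub>R \<eta>) \<bullet> \<eta>)) =
      - ((a * (1 - 1 / a\<^sup>2))\<^sup>2 + (1 - 1 / a\<^sup>2) * (norm (x - a *\<^sub>R \<eta>))\<^sup>2)"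
    unfolding r using assms(3)
    by (simp add: inner_diff_left 1 field_simps power2_eq_square)
qed

lemma norm_along_line:
  fixes y \<eta> :: "'a :: real_inner"
  assumes "norm \<eta> = 1"
  shows "(norm (y + t *\<^sub>R \<eta>))\<^sup>2 = (norm y)\<^sup>2 + 2 * (y \<bullet> \<eta>) * t + t\<^sup>2"
proof -
  have "\<eta> \<bullet> \<eta> = 1"
    using assms by (simp add: dot_square_norm)
  then show ?thesis
    unfolding power2_norm_eq_inner
    by (simp add: inner_add_left inner_add_right inner_commute[of \<eta> y] power2_eq_square algebra_simps)
qed

lemma norm_powi_eq_powr:
  fixes y :: "'a :: real_normed_vector"
  assumes "y \<noteq> 0"
  shows "norm y powi k = ((norm y)\<^sup>2) powr (real_of_int k / 2)"
proof -
  have "norm y powi k = norm y powr real_of_int k"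
    using assms by (simp add: powr_real_of_int')
  also have "\<dots> = (norm y powr 2) powr (real_of_int k / 2)"
    by (simp only: powr_powr) simp
  finally show ?thesis
    using assms by simp
qed

section \<open>The linear system for the coefficients\<close>

text \<open>
  Back substitution from the last row; the entry \<open>A \<nu> 0\<close> is on the diagonal.
\<close>
lemma triangular_system_unique_solution:
  fixes A :: "nat \<Rightarrow> nat \<Rightarrow> 'a :: comm_ring_1"
  assumes diag: "\<And>\<nu>. A \<nu> 0 = 1"
  shows "\<exists>!q. q m = b \<and> (\<forall>\<nu><m. (\<Sum>l = 0..m - \<nu>. A \<nu> l * q (\<nu> + l)) = 0) \<and> (\<forall>l>m. q l = 0)"
proof -
  have split: "(\<Sum>l = 0..m - \<nu>. A \<nu> l * q (\<nu> + l)) = q \<nu> + (\<Sum>l = 1..m - \<nu>. A \<nu> l * q (\<nu> + l))"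
    for \<nu> q
    by (simp add: sum.atLeast_Suc_atMost diag)
  have "\<exists>q. q m = b \<and> (\<forall>\<nu>\<in>{m - j..<m}. (\<Sum>l = 0..m - \<nu>. A \<nu> l * q (\<nu> + l)) = 0) \<and> (\<forall>l>m. q l = 0)" for j
  proof (induction j)
    case 0
    show ?case by (intro exI[of _ "\<lambda>l. if l = m then b else 0"]) auto
  next
    case (Suc j)
    then obtain q where q: "q m = b" "\<forall>l>m. q l = 0"
      "\<forall>\<nu>\<in>{m - j..<m}. (\<Sum>l = 0..m - \<nu>. A \<nu> l * q (\<nu> + l)) = 0" by blast
    show ?case
    proof (cases "Suc j \<le> m")
      case True
      define \<nu>0 where "\<nu>0 = m - Suc j"
      define p where "p = q(\<nu>0 := - (\<Sum>l = 1..m - \<nu>0. A \<nu>0 l * q (\<nu>0 + l)))"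
      have \<nu>0: "\<nu>0 < m" "m - j = Suc \<nu>0"
        using True by (auto simp: \<nu>0_def)
      have same: "(\<Sum>l = 1..m - \<nu>. A \<nu> l * p (\<nu> + l)) = (\<Sum>l = 1..m - \<nu>. A \<nu> l * q (\<nu> + l))"
        if "\<nu> \<ge> \<nu>0" for \<nu>
        using that by (intro sum.cong) (auto simp: p_def)
      have "(\<Sum>l = 0..m - \<nu>. A \<nu> l * p (\<nu> + l)) = 0" if "\<nu> \<in> {m - Suc j..<m}" for \<nu>
      proof (cases "\<nu> = \<nu>0")
        case True
        then show ?thesis
          unfolding split by (simp only: same) (simp add: p_def)
      next
        case False
        with that \<nu>0 have \<nu>: "\<nu> \<ge> \<nu>0" "\<nu> \<in> {m - j..<m}" "p \<nu> = q \<nu>"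
          by (auto simp: \<nu>0_def p_def)
        then show ?thesis
          using q(3) unfolding split by (simp only: same)
      qed
      moreover have "p m = b" "\<forall>l>m. p l = 0"
        using q \<nu>0 by (auto simp: p_def)
      ultimately show ?thesis by blast
    next
      case False
      then have "m - Suc j = m - j" by simp
      then show ?thesis using q by metis
    qed
  qed
  from this[of m] obtain q where
    q: "q m = b" "\<forall>\<nu><m. (\<Sum>l = 0..m - \<nu>. A \<nu> l * q (\<nu> + l)) = 0" "\<forall>l>m. q l = 0"
    by auto
  have uniq: "p = q" if p: "p m = b" "\<forall>\<nu><m. (\<Sum>l = 0..m - \<nu>. A \<nu> l * p (\<nu> + l)) = 0"
    "\<forall>l>m. p l = 0" for p
  proof -
    have "p (m - k) = q (m - k)" for k
    proof (induction k rule: less_induct)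
      case (less k)
      show ?case
      proof (cases "0 < k \<and> k \<le> m")
        case True
        define \<nu> where "\<nu> = m - k"
        have "\<nu> < m" using True by (simp add: \<nu>_def)
        have "p (\<nu> + l) = q (\<nu> + l)" if "l \<in> {1..m - \<nu>}" for l
        proof -
          have "m - (k - l) = \<nu> + l" "k - l < k"
            using that True by (auto simp: \<nu>_def)
          then show ?thesis using less.IH[of "k - l"] by simp
        qed
        then have "(\<Sum>l = 1..m - \<nu>. A \<nu> l * p (\<nu> + l)) = (\<Sum>l = 1..m - \<nu>. A \<nu> l * q (\<nu> + l))"
          by (intro sum.cong) auto
        moreover have "p \<nu> + (\<Sum>l = 1..m - \<nu>. A \<nu> l * p (\<nu> + l)) =
            q \<nu> + (\<Sum>l = 1..m - \<nu>. A \<nu> l * q (\<nu> + l))"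
          using p(2) q(2) \<open>\<nu> < m\<close> unfolding split by simp
        ultimately show ?thesis by (simp add: \<nu>_def)
      next
        case False
        then consider "k = 0" | "m - k = m - (k - 1)" "k - 1 < k" by force
        then show ?thesis
          using less.IH[of "k - 1"] p(1) q(1) by cases auto
      qed
    qed
    then have "p l = q l" if "l \<le> m" for l
      using that by (metis diff_diff_cancel)
    then show ?thesis
      using p(3) q(3) by (intro ext) (metis not_le)
  qed
  show ?thesis
    using q uniq by (intro ex1I[of _ q]) blast+
qed

lemma coeff_system_coeffs:
  assumes "m \<ge> 1"
  shows "coeff_system d \<delta> m (coeffs d \<delta> m)"
proof -
  \<comment> \<open>Row \<open>0\<close> is the equation for \<open>q 0\<close>, the rows \<open>1, ..., m - 1\<close> are the other homogeneous equations.\<close>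
  define A where "A \<nu> l = (if \<nu> = 0
      then if l = 0 then 1 else pochhammer (real d / 2) (l - 1) * (\<delta> ^ (l - 1) / (2 * fact l))
      else \<Sum>k = l - \<nu>..l. (-1) ^ (l - k) * real (\<nu> choose (l - k)) *
              pochhammer (real d / 2 + real \<nu> - 1) k * (\<delta> ^ k / fact k))" for \<nu> l :: nat
  have "A \<nu> 0 = 1" for \<nu>
    by (simp add: A_def)
  then have "\<exists>!q. q m = 1 \<and> (\<forall>\<nu><m. (\<Sum>l = 0..m - \<nu>. A \<nu> l * q (\<nu> + l)) = 0) \<and> (\<forall>l>m. q l = 0)"
    by (rule triangular_system_unique_solution)
  also have "(\<lambda>q. q m = 1 \<and> (\<forall>\<nu><m. (\<Sum>l = 0..m - \<nu>. A \<nu> l * q (\<nu> + l)) = 0) \<and> (\<forall>l>m. q l = 0))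
      = (\<lambda>q. coeff_system d \<delta> m q \<and> (\<forall>l>m. q l = 0))"
  proof
    fix q :: "nat \<Rightarrow> real"
    have e1: "(\<forall>\<nu><m. (\<Sum>l = 0..m - \<nu>. A \<nu> l * q (\<nu> + l)) = 0) \<longleftrightarrow>
        (\<Sum>l = 0..m. A 0 l * q l) = 0 \<and> (\<forall>\<nu>\<in>{1..m - 1}. (\<Sum>l = 0..m - \<nu>. A \<nu> l * q (\<nu> + l)) = 0)"
    proof -
      have "(\<forall>\<nu><m. P \<nu>) \<longleftrightarrow> P 0 \<and> (\<forall>\<nu>\<in>{1..m - 1}. P \<nu>)" for P
      proof -
        have "{..<m} = insert 0 {1..m - 1}" using assms by auto
        then show ?thesis by (metis insert_iff lessThan_iff)
      qed
      from this[of "\<lambda>\<nu>. (\<Sum>l = 0..m - \<nu>. A \<nu> l * q (\<nu> + l)) = 0"] show ?thesis by simp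
    qed
    have e2: "(\<Sum>l = 0..m. A 0 l * q l) = q 0 +
        (\<Sum>l = 1..m. pochhammer (real d / 2) (l - 1) * (\<delta> ^ (l - 1) / (2 * fact l)) * q l)"
      by (simp add: sum.atLeast_Suc_atMost A_def)
    have e3: "(\<forall>\<nu>\<in>{1..m - 1}. (\<Sum>l = 0..m - \<nu>. A \<nu> l * q (\<nu> + l)) = 0) \<longleftrightarrow>
        (\<forall>\<nu>\<in>{1..m - 1}. (\<Sum>l = 0..m - \<nu>. (\<Sum>k = l - \<nu>..l. (-1) ^ (l - k) * real (\<nu> choose (l - k)) *
              pochhammer (real d / 2 + real \<nu> - 1) k * (\<delta> ^ k / fact k)) * q (\<nu> + l)) = 0)"
      by (intro ball_cong arg_cong2[of _ _ _ _ "(=)"] sum.cong refl) (auto simp: A_def)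
    show "(q m = 1 \<and> (\<forall>\<nu><m. (\<Sum>l = 0..m - \<nu>. A \<nu> l * q (\<nu> + l)) = 0) \<and> (\<forall>l>m. q l = 0))
        = (coeff_system d \<delta> m q \<and> (\<forall>l>m. q l = 0))"
      unfolding e1 unfolding e2 e3 coeff_system_def by blast
  qed
  finally have "coeff_system d \<delta> m (coeffs d \<delta> m) \<and> (\<forall>l>m. coeffs d \<delta> m l = 0)"
    unfolding coeffs_def by (rule theI')
  then show ?thesis
    by simp
qed

text \<open>
  Exchanging the two summations groups the left-hand side by powers of \<open>z\<close>. The first equation of the
  system removes the constant term, the row \<open>\<nu>\<close> removes \<open>z^\<nu>\<close> for \<open>0 < \<nu> < m\<close>, and \<open>z^m\<close> remains.
\<close>
lemma coeff_system_collapse: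
  assumes sys: "coeff_system d s m q" and "m \<ge> 1" "s \<noteq> 0"
  defines "\<mu> \<equiv> real d / 2 - 1"
  shows "q 0 + (\<Sum>l = 1..m. q l / s * kernel_fps \<mu> s z $ l) = potential_fps \<mu> 1 $ m * z ^ m / s"
proof -
  have row: "(\<Sum>l = 0..m - \<nu>. system_entry \<mu> s \<nu> l * q (\<nu> + l)) = (if \<nu> = m then 1 else 0)"
    if "\<nu> \<in> {1..m}" for \<nu>
  proof (cases "\<nu> = m")
    case True
    then show ?thesis
      using sys by (simp add: coeff_system_def system_entry_def)
  next
    case False
    then have \<nu>: "\<nu> \<in> {1..m - 1}"
      using that by auto
    have \<mu>: "\<mu> + real \<nu> = real d / 2 + real \<nu> - 1"
      by (simp add: \<mu>_def)
    have "(\<Sum>l = 0..m - \<nu>. system_entry \<mu> s \<nu> l * q (\<nu> + l)) = 0"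
      unfolding system_entry_def \<mu> using sys \<nu> unfolding coeff_system_def by blast
    with False show ?thesis by simp
  qed
  have "(\<Sum>l = 1..m. q l * (\<Sum>\<nu> = 1..l. potential_fps \<mu> 1 $ \<nu> * z ^ \<nu> * system_entry \<mu> s \<nu> (l - \<nu>))) =
      (\<Sum>l = 1..m. \<Sum>\<nu> = 1..l. potential_fps \<mu> 1 $ \<nu> * z ^ \<nu> * (system_entry \<mu> s \<nu> (l - \<nu>) * q l))"
    by (simp add: sum_distrib_left mult_ac)
  also have "\<dots> = (\<Sum>\<nu> = 1..m. \<Sum>l = \<nu>..m. potential_fps \<mu> 1 $ \<nu> * z ^ \<nu> * (system_entry \<mu> s \<nu> (l - \<nu>) * q l))"
    unfolding sum.Sigma[OF finite_atLeastAtMost ballI[OF finite_atLeastAtMost]]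
    by (rule sum.reindex_bij_witness[of _ "\<lambda>(\<nu>, l). (l, \<nu>)" "\<lambda>(l, \<nu>). (\<nu>, l)"]) auto
  also have "\<dots> = (\<Sum>\<nu> = 1..m. potential_fps \<mu> 1 $ \<nu> * z ^ \<nu> * (\<Sum>l = 0..m - \<nu>. system_entry \<mu> s \<nu> l * q (\<nu> + l)))"
  proof (intro sum.cong refl)
    fix \<nu> assume "\<nu> \<in> {1..m}"
    have "(\<Sum>l = \<nu>..m. system_entry \<mu> s \<nu> (l - \<nu>) * q l) = (\<Sum>l = 0..m - \<nu>. system_entry \<mu> s \<nu> l * q (\<nu> + l))"
      by (rule sum.reindex_bij_witness[of _ "\<lambda>l. \<nu> + l" "\<lambda>l. l - \<nu>"]) (use \<open>\<nu> \<in> {1..m}\<close> in auto)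
    then show "(\<Sum>l = \<nu>..m. potential_fps \<mu> 1 $ \<nu> * z ^ \<nu> * (system_entry \<mu> s \<nu> (l - \<nu>) * q l)) =
        potential_fps \<mu> 1 $ \<nu> * z ^ \<nu> * (\<Sum>l = 0..m - \<nu>. system_entry \<mu> s \<nu> l * q (\<nu> + l))"
      by (simp add: sum_distrib_left[symmetric])
  qed
  also have "\<dots> = (\<Sum>\<nu> = 1..m. if \<nu> = m then potential_fps \<mu> 1 $ \<nu> * z ^ \<nu> else 0)"
    by (intro sum.cong refl) (simp only: row, simp)
  also have "\<dots> = potential_fps \<mu> 1 $ m * z ^ m"
    using \<open>m \<ge> 1\<close> by simp
  finally have high: "(\<Sum>l = 1..m. q l * (\<Sum>\<nu> = 1..l. potential_fps \<mu> 1 $ \<nu> * z ^ \<nu> * system_entry \<mu> s \<nu> (l - \<nu>))) =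
      potential_fps \<mu> 1 $ m * z ^ m" .
  have "(\<Sum>l = 1..m. q l * potential_fps \<mu> s $ l) =
      s * (\<Sum>l = 1..m. pochhammer (real d / 2) (l - 1) * (s ^ (l - 1) / (2 * fact l)) * q l)"
    unfolding sum_distrib_left
  proof (intro sum.cong refl)
    fix l assume "l \<in> {1..m}"
    then obtain j where "l = Suc j" by (cases l) auto
    then show "q l * potential_fps \<mu> s $ l =
        s * (pochhammer (real d / 2) (l - 1) * (s ^ (l - 1) / (2 * fact l)) * q l)"
      by (simp add: potential_fps_def \<mu>_def)
  qed
  also have "\<dots> = - s * q 0"
    using sys by (simp add: coeff_system_def algebra_simps add_eq_0_iff)
  finally have low: "(\<Sum>l = 1..m. q l * potential_fps \<mu> s $ l) = - s * q 0" .
  have "(\<Sum>l = 1..m. q l / s * kernel_fps \<mu> s z $ l) =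
      ((\<Sum>l = 1..m. q l * potential_fps \<mu> s $ l) +
       (\<Sum>l = 1..m. q l * (\<Sum>\<nu> = 1..l. potential_fps \<mu> 1 $ \<nu> * z ^ \<nu> * system_entry \<mu> s \<nu> (l - \<nu>)))) / s"
    by (simp add: kernel_fps_nth sum.distrib[symmetric] sum_divide_distrib ring_distribs add_divide_distrib)
  also have "\<dots> = potential_fps \<mu> 1 $ m * z ^ m / s - q 0"
    unfolding low high using \<open>s \<noteq> 0\<close> by (simp add: field_simps)
  finally show ?thesis by simp
qed

section \<open>The kernel on the unit sphere\<close>

text \<open>
  In the following, \<open>a\<eta>\<close> is the pole of the kernel, \<open>r\<close> the distance to it from the point \<open>x\<close> of the
  sphere, and \<open>\<kappa> = a - 1/a\<close>.
\<close>
context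
  fixes x \<eta> :: "real ^ 'n" and \<epsilon> a \<delta> \<kappa> r :: real
  assumes x: "norm x = 1" and \<eta>: "norm \<eta> = 1" and \<epsilon>: "\<epsilon> > 0"
  defines "a \<equiv> 1 + \<epsilon>" and "\<delta> \<equiv> 1 - 1 / a\<^sup>2" and "\<kappa> \<equiv> a * \<delta>" and "r \<equiv> norm (x - a *\<^sub>R \<eta>)"
begin

text \<open>
  The first statement is for an arbitrary integer power of the distance to the pole; the Newtonian
  potential in dimension \<open>d > 2\<close> is the power \<open>k = 2 - d\<close>.
\<close>
lemma dir_deriv_newton_on_sphere:
  assumes "n \<ge> 1"
  shows "\<kappa> ^ n / fact n * (dir_deriv \<eta> ^^ n) (\<lambda>z. norm (z - a *\<^sub>R \<eta>) powi k) x =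
      - k * r powi k * kernel_fps (- k / 2) \<delta> (\<kappa>\<^sup>2 / r\<^sup>2) $ n" (is ?newton)
    and "\<kappa> ^ n / fact n * (dir_deriv \<eta> ^^ n) (\<lambda>z. ln (1 / norm (z - a *\<^sub>R \<eta>))) x =
      kernel_fps 0 \<delta> (\<kappa>\<^sup>2 / r\<^sup>2) $ n" (is ?log)
proof -
  define y where "y = x - a *\<^sub>R \<eta>"
  define q1 where "q1 = 2 * (y \<bullet> \<eta>)"
  define Q where "Q t = r\<^sup>2 + q1 * t + t\<^sup>2" for t
  define U where "U = {t. Q t > 0}"
  have y0: "y \<noteq> 0"
    using x \<eta> \<epsilon> by (auto simp: y_def a_def)
  have Q: "(norm (y + t *\<^sub>R \<eta>))\<^sup>2 = Q t" for t
    by (simp add: norm_along_line[OF \<eta>] Q_def q1_def r_def y_def)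
  have nz: "y + t *\<^sub>R \<eta> \<noteq> 0" if "t \<in> U" for t
    using that Q[of t] by (auto simp: U_def)
  have "continuous_on UNIV Q"
    unfolding Q_def by (intro continuous_intros)
  then have U: "open U"
    unfolding U_def by (intro open_Collect_less) auto
  have U0: "0 \<in> U"
    using y0 by (simp add: U_def Q_def r_def y_def)
  have \<kappa>0: "\<kappa> \<noteq> 0"
  proof -
    have "a\<^sup>2 > 1" using \<epsilon> by (simp add: a_def)
    then show ?thesis by (auto simp: \<kappa>_def \<delta>_def)
  qed
  have q1: "\<kappa> * q1 = - (\<kappa>\<^sup>2 + \<delta> * r\<^sup>2)"
    using sphere_pole_geometry(2)[OF x \<eta>, of a] \<epsilon> by (simp add: \<kappa>_def \<delta>_def q1_def r_def y_def a_def)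
  have dQ: "(Q has_real_derivative q1 + 2 * t) (at t)" for t
    unfolding Q_def by (auto intro!: derivative_eq_intros)
  have line: "(dir_deriv \<eta> ^^ n) (\<lambda>z. g (z - a *\<^sub>R \<eta>)) x = (deriv ^^ n) (\<lambda>t. g (y + t *\<^sub>R \<eta>)) 0"
    for g :: "real ^ 'n \<Rightarrow> real"
    using funpow_dir_deriv[where \<eta> = \<eta> and n = n and g = "\<lambda>z. g (z - a *\<^sub>R \<eta>)" and x = x and t = 0]
    by (simp add: y_def algebra_simps)
  have pos: "r\<^sup>2 + q1 * t + t\<^sup>2 \<noteq> 0" if "t \<in> U" for t
    using that by (simp add: U_def Q_def)
  have "\<kappa> ^ n / fact n * (deriv ^^ n) (\<lambda>t. norm (y + t *\<^sub>R \<eta>) powi k) 0 =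
      2 * ((- k / 2) * norm (y + 0 *\<^sub>R \<eta>) powi k + 0) * kernel_fps (- k / 2) \<delta> (\<kappa>\<^sup>2 / r\<^sup>2) $ n"
  proof (rule Taylor_coeff_kernel_fps[OF pos U U0 _ q1 \<kappa>0 assms])
    fix t assume t: "t \<in> U"
    have "((\<lambda>t. Q t powr (k / 2)) has_real_derivative k / 2 * Q t powr (k / 2 - 1) * (q1 + 2 * t)) (at t)"
      using t by (auto intro!: derivative_eq_intros dQ simp: U_def)
    also have "k / 2 * Q t powr (k / 2 - 1) * (q1 + 2 * t) =
        - (q1 + 2 * t) * (- k / 2 * norm (y + t *\<^sub>R \<eta>) powi k + 0) / (r\<^sup>2 + q1 * t + t\<^sup>2)"
    proof -
      have alg: "K / 2 * (P / D) * w = - w * (- K / 2 * P + 0) / D" for K P D w :: real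
        by simp
      have "Q t powr (k / 2 - 1) = Q t powr (k / 2) / Q t"
        using t by (simp add: powr_diff U_def)
      then show ?thesis
        unfolding norm_powi_eq_powr[OF nz[OF t]] Q Q_def[of t, symmetric] by (simp only: alg of_int_minus)
    qed
    finally show "((\<lambda>t. norm (y + t *\<^sub>R \<eta>) powi k) has_real_derivative
        - (q1 + 2 * t) * (- k / 2 * norm (y + t *\<^sub>R \<eta>) powi k + 0) / (r\<^sup>2 + q1 * t + t\<^sup>2)) (at t)"
      using U t by (rule has_field_derivative_transform_within_open)
        (simp add: norm_powi_eq_powr[OF nz] Q)
  qed
  then show ?newton
    unfolding line[of "\<lambda>z. norm z powi k"] by (simp add: r_def y_def)
  have lnQ: "ln (1 / norm (y + t *\<^sub>R \<eta>)) = - (1/2) * ln (Q t)" if "t \<in> U" for t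
    using nz[OF that] by (simp add: ln_div ln_realpow flip: Q)
  have "\<kappa> ^ n / fact n * (deriv ^^ n) (\<lambda>t. ln (1 / norm (y + t *\<^sub>R \<eta>))) 0 =
      2 * (0 * ln (1 / norm (y + 0 *\<^sub>R \<eta>)) + 1 / 2) * kernel_fps 0 \<delta> (\<kappa>\<^sup>2 / r\<^sup>2) $ n"
  proof (rule Taylor_coeff_kernel_fps[OF pos U U0 _ q1 \<kappa>0 assms])
    fix t assume t: "t \<in> U"
    have "((\<lambda>t. - (1/2) * ln (Q t)) has_real_derivative
        - (q1 + 2 * t) * (0 * ln (1 / norm (y + t *\<^sub>R \<eta>)) + 1 / 2) / Q t) (at t)"
      using t by (auto intro!: derivative_eq_intros dQ simp: U_def field_simps)
    then show "((\<lambda>t. ln (1 / norm (y + t *\<^sub>R \<eta>))) has_real_derivative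
        - (q1 + 2 * t) * (0 * ln (1 / norm (y + t *\<^sub>R \<eta>)) + 1 / 2) / (r\<^sup>2 + q1 * t + t\<^sup>2)) (at t)"
      unfolding Q_def[symmetric] using U t
      by (rule has_field_derivative_transform_within_open) (simp add: lnQ)
  qed
  then show ?log
    unfolding line[of "\<lambda>z. ln (1 / norm z)"] by simp
qed

lemma pole_parameters_pos: "\<delta> > 0" "\<kappa> > 0" "r > 0"
proof -
  have a1: "a > 1"
    using \<epsilon> by (simp add: a_def)
  then have "a\<^sup>2 > 1"
    by (simp add: power_less_one_iff)
  then show \<delta>: "\<delta> > 0"
    using a1 by (simp add: \<delta>_def divide_simps)
  with a1 show "\<kappa> > 0"
    by (simp add: \<kappa>_def)
  have "x \<noteq> a *\<^sub>R \<eta>"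
    using x \<eta> a1 by auto
  then show "r > 0"
    by (simp add: r_def)
qed

text \<open>
  The factor \<open>d - 2\<close> by which the kernel is divided for \<open>d > 2\<close> is the factor \<open>- k\<close> in front of the
  Taylor coefficients of the power \<open>k = 2 - d\<close>; for the logarithm neither of them occurs.
\<close>
lemma kernel_H_on_sphere:
  assumes d: "CARD('n) \<ge> 2" and m: "m \<ge> 1"
  shows "kernel_H \<epsilon> m \<eta> x =
    potential_fps (real CARD('n) / 2 - 1) 1 $ m * \<kappa> ^ (2 * m) / \<delta> / r ^ (2 * m + CARD('n) - 2)"
proof -
  define q where "q = coeffs CARD('n) \<delta> m"
  define \<mu> where "\<mu> = real CARD('n) / 2 - 1"
  define k where "k = 2 - int CARD('n)"
  note pos = pole_parameters_pos
  have \<kappa>_pow: "\<kappa> ^ l / \<delta> = \<delta> ^ (l - 1) * a ^ l" if "l \<ge> 1" for l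
    using that pos by (cases l) (simp_all add: \<kappa>_def power_mult_distrib)
  have "q 0 + (\<Sum>l = 1..m. q l / \<delta> * kernel_fps \<mu> \<delta> (\<kappa>\<^sup>2 / r\<^sup>2) $ l) =
      potential_fps \<mu> 1 $ m * (\<kappa>\<^sup>2 / r\<^sup>2) ^ m / \<delta>"
    unfolding \<mu>_def q_def
    using coeff_system_collapse[OF coeff_system_coeffs[OF m] m, of \<delta>] pos by simp
  also have "(\<kappa>\<^sup>2 / r\<^sup>2) ^ m = \<kappa> ^ (2 * m) / r ^ (2 * m)"
    by (simp add: power_divide power_mult)
  finally have sum: "q 0 + (\<Sum>l = 1..m. q l / \<delta> * kernel_fps \<mu> \<delta> (\<kappa>\<^sup>2 / r\<^sup>2) $ l) =
      potential_fps \<mu> 1 $ m * \<kappa> ^ (2 * m) / \<delta> / r ^ (2 * m)"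
    by simp
  have "kernel_H \<epsilon> m \<eta> x = r powi k *
      (q 0 + (\<Sum>l = 1..m. q l / \<delta> * kernel_fps \<mu> \<delta> (\<kappa>\<^sup>2 / r\<^sup>2) $ l))"
  proof (cases "CARD('n) = 2")
    case True
    have "q l * \<delta> ^ (l - 1) * a ^ l / fact l *
          (dir_deriv \<eta> ^^ l) (\<lambda>z. ln (1 / norm (z - a *\<^sub>R \<eta>))) x =
        q l / \<delta> * kernel_fps \<mu> \<delta> (\<kappa>\<^sup>2 / r\<^sup>2) $ l" if "l \<in> {1..m}" for l
    proof -
      have l: "l \<ge> 1" using that by simp
      have "q l * \<delta> ^ (l - 1) * a ^ l / fact l * D = q l * (\<delta> ^ (l - 1) * a ^ l) / fact l * D"
        for D by simp
      also have "q l * (\<delta> ^ (l - 1) * a ^ l) / fact l * D = q l / \<delta> * (\<kappa> ^ l / fact l * D)" for D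
        unfolding \<kappa>_pow[OF l, symmetric] by simp
      finally show ?thesis
        using dir_deriv_newton_on_sphere(2)[OF l] True by (simp only: \<mu>_def) simp
    qed
    then show ?thesis
      using True by (simp add: kernel_H_def Let_def k_def q_def \<delta>_def a_def)
  next
    case False
    then have d2: "real CARD('n) - 2 > 0"
      using d by simp
    have "q l * \<delta> ^ (l - 1) * a ^ l / (fact l * (real CARD('n) - 2)) *
          (dir_deriv \<eta> ^^ l) (\<lambda>z. norm (z - a *\<^sub>R \<eta>) powi k) x =
        r powi k * (q l / \<delta> * kernel_fps \<mu> \<delta> (\<kappa>\<^sup>2 / r\<^sup>2) $ l)" if "l \<in> {1..m}" for l
    proof -
      have l: "l \<ge> 1" using that by simp
      define D where "D = (dir_deriv \<eta> ^^ l) (\<lambda>z. norm (z - a *\<^sub>R \<eta>) powi k) x"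
      have "- real_of_int k = real CARD('n) - 2" "- real_of_int k / 2 = \<mu>"
        by (simp_all add: k_def \<mu>_def field_simps)
      then have D: "\<kappa> ^ l / fact l * D =
          (real CARD('n) - 2) * r powi k * kernel_fps \<mu> \<delta> (\<kappa>\<^sup>2 / r\<^sup>2) $ l"
        using dir_deriv_newton_on_sphere(1)[OF l, of k] by (simp only: D_def)
      have "q l * \<delta> ^ (l - 1) * a ^ l / (fact l * (real CARD('n) - 2)) * D =
          q l * (\<delta> ^ (l - 1) * a ^ l) / (fact l * (real CARD('n) - 2)) * D"
        by (simp only: mult.assoc)
      also have "\<dots> = q l / \<delta> / (real CARD('n) - 2) * (\<kappa> ^ l / fact l * D)"
        unfolding \<kappa>_pow[OF l, symmetric] by (simp only: times_divide_eq_left times_divide_eq_right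
            divide_divide_eq_left divide_divide_eq_right mult_ac)
      also have "\<dots> = r powi k * (q l / \<delta> * kernel_fps \<mu> \<delta> (\<kappa>\<^sup>2 / r\<^sup>2) $ l)"
        unfolding D using d2 by simp
      finally show ?thesis
        unfolding D_def .
    qed
    then show ?thesis
      using False by (simp add: kernel_H_def Let_def r_def k_def q_def \<delta>_def a_def sum_distrib_left distrib_left)
  qed
  also note sum
  also have "r powi k = inverse (r ^ (CARD('n) - 2))"
  proof -
    have "k = - int (CARD('n) - 2)"
      using d by (simp add: k_def)
    then show ?thesis
      by (simp add: power_int_minus)
  qed
  also have "inverse (r ^ (CARD('n) - 2)) * (potential_fps \<mu> 1 $ m * \<kappa> ^ (2 * m) / \<delta> / r ^ (2 * m)) =
      potential_fps \<mu> 1 $ m * \<kappa> ^ (2 * m) / \<delta> / r ^ (2 * m + CARD('n) - 2)"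
  proof -
    have "2 * m + CARD('n) - 2 = 2 * m + (CARD('n) - 2)"
      using d by simp
    then show ?thesis
      by (simp add: power_add field_simps)
  qed
  finally show ?thesis
    unfolding \<mu>_def .
qed

end

section \<open>The surface measure of the sphere\<close>

text \<open>
  Uniqueness of translation invariant measures in a concrete form. For a Borel set \<open>A\<close> and the unit
  ball \<open>B\<close>, two translations and two exchanges of the order of integration turn the double integral of
  \<open>1\<^sub>A (f x) 1\<^sub>B (y)\<close> into that of \<open>1\<^sub>A (y) 1\<^sub>B (y - f x)\<close>. The first is the image measure
  of \<open>A\<close> times the measure of \<open>B\<close>; since \<open>f\<close> maps balls to balls of the same radius, the second is the
  product of the measures of \<open>A\<close> and \<open>B\<close>.
\<close>
lemma distr_lborel_orthogonal:
  fixes f :: "'a :: euclidean_space \<Rightarrow> 'a"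
  assumes f: "orthogonal_transformation f"
  shows "distr lborel borel f = lborel"
proof -
  have lin: "linear f"
    using f by (rule orthogonal_transformation_linear)
  have fm [measurable]: "f \<in> borel_measurable borel"
    using lin by (intro borel_measurable_continuous_onI linear_continuous_on linear_conv_bounded_linear[THEN iffD1])
  obtain g where g: "orthogonal_transformation g" "\<And>x. f (g x) = x"
    using orthogonal_transformation_inv[OF f] orthogonal_transformation_bij[OF f]
    by (metis bij_def surj_f_inv_f)
  have shift: "(\<integral>\<^sup>+x. h (c + x) \<partial>lborel) = (\<integral>\<^sup>+x. h x \<partial>lborel)"
    if [measurable]: "h \<in> borel_measurable borel" for h :: "'a \<Rightarrow> ennreal" and c
  proof -
    have "(\<integral>\<^sup>+x. h x \<partial>lborel) = (\<integral>\<^sup>+x. h x \<partial>distr lborel borel ((+) c))"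
      by (simp add: lborel_distr_plus)
    also have "\<dots> = (\<integral>\<^sup>+x. h (c + x) \<partial>lborel)"
      by (subst nn_integral_distr) auto
    finally show ?thesis ..
  qed
  define B :: "'a set" where "B = ball 0 1"
  have B [measurable]: "B \<in> sets borel"
    by (simp add: B_def)
  have B_fin: "emeasure lborel B \<noteq> 0" "emeasure lborel B \<noteq> \<infinity>"
  proof -
    have "unit_ball_vol (real DIM('a)) \<noteq> 0"
      by (metis less_irrefl of_nat_0_le_iff unit_ball_vol_pos)
    then show "emeasure lborel B \<noteq> 0" "emeasure lborel B \<noteq> \<infinity>"
      by (simp_all add: B_def emeasure_ball)
  qed
  show ?thesis
  proof (rule measure_eqI)
    fix A :: "'a set" assume "A \<in> sets (distr lborel borel f)"
    then have A [measurable]: "A \<in> sets borel" by simp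
    have iA [measurable]: "indicator A \<in> borel_measurable (borel :: 'a measure)"
      "indicator B \<in> borel_measurable (borel :: 'a measure)" by measurable
    have ball: "(\<integral>\<^sup>+x. indicator B (y - f x) \<partial>lborel) = emeasure lborel B" for y
    proof -
      have "y - f x \<in> B \<longleftrightarrow> x \<in> ball (g y) 1" for x
      proof -
        have "y - f x = f (g y - x)"
          by (simp add: linear_diff[OF lin] g)
        then show ?thesis
          by (simp add: B_def dist_norm orthogonal_transformation_norm[OF f])
      qed
      then have "(\<integral>\<^sup>+x. indicator B (y - f x) \<partial>lborel) = (\<integral>\<^sup>+x. indicator (ball (g y) 1) x \<partial>lborel)"
        by (intro nn_integral_cong) (simp add: indicator_def)
      then show ?thesis
        by (simp add: B_def emeasure_ball)
    qed
    have "emeasure (distr lborel borel f) A = (\<integral>\<^sup>+x. indicator A x \<partial>distr lborel borel f)"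
      by simp
    also have "\<dots> = (\<integral>\<^sup>+x. indicator A (f x) \<partial>lborel)"
      by (intro nn_integral_distr) auto
    finally have "emeasure (distr lborel borel f) A * emeasure lborel B =
        (\<integral>\<^sup>+y. (\<integral>\<^sup>+x. indicator A (f x) * indicator B y \<partial>lborel) \<partial>lborel)"
      by (simp add: nn_integral_multc nn_integral_cmult)
    also have "\<dots> = (\<integral>\<^sup>+y. (\<integral>\<^sup>+x. indicator A (f (g y + x)) * indicator B y \<partial>lborel) \<partial>lborel)"
      by (intro nn_integral_cong shift[symmetric]) measurable
    also have "\<dots> = (\<integral>\<^sup>+x. (\<integral>\<^sup>+y. indicator A (f x + y) * indicator B y \<partial>lborel) \<partial>lborel)"
      by (subst lborel_pair.Fubini') (simp_all add: linear_add[OF lin] g add.commute)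
    also have "\<dots> = (\<integral>\<^sup>+x. (\<integral>\<^sup>+y. indicator A (f x + (- f x + y)) * indicator B (- f x + y) \<partial>lborel) \<partial>lborel)"
      by (intro nn_integral_cong shift[symmetric]) measurable
    also have "\<dots> = (\<integral>\<^sup>+y. (\<integral>\<^sup>+x. indicator A y * indicator B (y - f x) \<partial>lborel) \<partial>lborel)"
      by (subst lborel_pair.Fubini') (simp_all)
    also have "\<dots> = (\<integral>\<^sup>+y. indicator A y * emeasure lborel B \<partial>lborel)"
      by (simp add: nn_integral_cmult ball)
    also have "\<dots> = emeasure lborel A * emeasure lborel B"
      by (simp add: nn_integral_multc)
    finally show "emeasure (distr lborel borel f) A = emeasure lborel A"
      using B_fin by (simp add: ennreal_mult_cancel_left mult.commute[of _ "emeasure lborel B"])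
  qed simp
qed

lemma measurable_sphere_measureI:
  assumes "f \<in> borel_measurable borel"
  shows "f \<in> borel_measurable sphere_measure"
  using measurable_restrict_space1[OF assms]
  by (subst measurable_cong_sets[OF sets_sphere_measure refl])

lemma emeasure_sphere_measure_finite: "emeasure sphere_measure (sphere 0 1 :: (real ^ 'n) set) < \<infinity>"
proof -
  have "sphere 0 1 \<in> sets (sphere_measure :: (real ^ 'n) measure)"
    using sets.top[of "sphere_measure :: (real ^ 'n) measure"] by simp
  then have "emeasure sphere_measure (sphere 0 1 :: (real ^ 'n) set) =
      of_nat CARD('n) * emeasure lborel {x \<in> ball 0 1 - {0 :: real ^ 'n}. sgn x \<in> sphere 0 1}"
    by (rule emeasure_sphere_measure)
  also have "\<dots> \<le> of_nat CARD('n) * emeasure lborel (ball (0 :: real ^ 'n) 1)"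
    by (intro mult_left_mono emeasure_mono) auto
  also have "\<dots> < \<infinity>"
    by (simp add: emeasure_ball ennreal_mult_less_top of_nat_less_top)
  finally show ?thesis .
qed

lemma finite_measure_sphere_measure: "finite_measure (sphere_measure :: (real ^ 'n) measure)"
  using emeasure_sphere_measure_finite by (intro finite_measureI) (simp add: less_top)

lemma sphere_measure_orthogonal_invariant:
  fixes T :: "real ^ 'n \<Rightarrow> real ^ 'n"
  assumes T: "orthogonal_transformation T"
  shows "distr sphere_measure sphere_measure T = sphere_measure"
proof (rule measure_eqI)
  have lin: "linear T"
    using T by (rule orthogonal_transformation_linear)
  have Tm: "T \<in> borel_measurable borel"
    using lin by (intro borel_measurable_continuous_onI linear_continuous_on linear_conv_bounded_linear[THEN iffD1])
  have meas: "T \<in> measurable sphere_measure sphere_measure"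
    unfolding measurable_cong_sets[OF sets_sphere_measure sets_sphere_measure]
    by (intro measurable_restrict_space3 Tm) (simp add: orthogonal_transformation_norm[OF T])
  fix A assume "A \<in> sets (distr (sphere_measure :: (real ^ 'n) measure) sphere_measure T)"
  then have A: "A \<in> sets (sphere_measure :: (real ^ 'n) measure)" by simp
  define C where "C = {x \<in> ball 0 1 - {0 :: real ^ 'n}. sgn x \<in> A}"
  have "A \<in> sets borel"
    using A by (auto simp: sets_restrict_space_iff)
  have sgn_m: "(sgn :: real ^ 'n \<Rightarrow> real ^ 'n) \<in> borel_measurable borel"
    unfolding sgn_div_norm[abs_def] by measurable
  have "C = (ball 0 1 - {0}) \<inter> sgn -` A"
    by (auto simp: C_def)
  then have C: "C \<in> sets borel"
    using measurable_sets[OF sgn_m \<open>A \<in> sets borel\<close>] by auto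
  have sgnT: "sgn (T x) = T (sgn x)" for x
    by (simp add: sgn_div_norm orthogonal_transformation_norm[OF T] linear_scale[OF lin])
  have "T x = 0 \<longleftrightarrow> x = 0" for x
    by (metis T norm_eq_zero orthogonal_transformation_norm)
  then have vim: "{x \<in> ball 0 1 - {0}. sgn x \<in> T -` A \<inter> sphere 0 1} = T -` C"
    by (auto simp: C_def orthogonal_transformation_norm[OF T] sgnT norm_sgn)
  have "emeasure (distr sphere_measure sphere_measure T) A = emeasure sphere_measure (T -` A \<inter> sphere 0 1)"
    using emeasure_distr[OF meas A] by simp
  also have "\<dots> = of_nat CARD('n) * emeasure lborel (T -` C)"
    using measurable_sets[OF meas A] unfolding vim[symmetric]
    by (intro emeasure_sphere_measure) simp
  also have "emeasure lborel (T -` C) = emeasure (distr lborel borel T) C"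
    using Tm C by (subst emeasure_distr) auto
  also have "\<dots> = emeasure lborel C"
    by (simp add: distr_lborel_orthogonal[OF T])
  also have "of_nat CARD('n) * emeasure lborel C = emeasure sphere_measure A"
    unfolding C_def by (rule emeasure_sphere_measure[OF A, symmetric])
  finally show "emeasure (distr sphere_measure sphere_measure T) A = emeasure sphere_measure A" .
qed simp

lemma zonal_integral_eq:
  fixes \<eta> \<xi> :: "real ^ 'n" and g :: "real \<Rightarrow> real"
  assumes "norm \<eta> = norm \<xi>" and g: "g \<in> borel_measurable borel"
  shows "(LINT y|sphere_measure. g (y \<bullet> \<eta>)) = (LINT y|sphere_measure. g (y \<bullet> \<xi>))"
proof -
  obtain T where T: "orthogonal_transformation T" "T \<eta> = \<xi>"
    using orthogonal_transformation_exists[OF assms(1)] by blast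
  have lin: "linear T"
    using T by (simp add: orthogonal_transformation_linear)
  have meas: "T \<in> measurable sphere_measure sphere_measure"
    unfolding measurable_cong_sets[OF sets_sphere_measure sets_sphere_measure]
    by (intro measurable_restrict_space3 borel_measurable_continuous_onI linear_continuous_on
        linear_conv_bounded_linear[THEN iffD1] lin)
      (simp add: orthogonal_transformation_norm[OF T(1)])
  have gm: "(\<lambda>y. g (y \<bullet> \<xi>)) \<in> borel_measurable sphere_measure"
    by (intro measurable_sphere_measureI measurable_compose[OF _ g]) measurable
  have "(LINT y|sphere_measure. g (y \<bullet> \<xi>)) = (LINT y|distr sphere_measure sphere_measure T. g (y \<bullet> \<xi>))"
    by (simp only: sphere_measure_orthogonal_invariant[OF T(1)])
  also have "\<dots> = (LINT y|sphere_measure. g (T y \<bullet> \<xi>))"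
    by (rule integral_distr[OF meas gm])
  also have "\<dots> = (LINT y|sphere_measure. g (y \<bullet> \<eta>))"
    using T(1) by (simp add: T(2)[symmetric] orthogonal_transformation_def)
  finally show ?thesis ..
qed

lemma dist_sgn_ray_le:
  fixes y \<eta> :: "'a :: real_normed_vector"
  assumes "norm \<eta> = 1" "s > 0" "y \<noteq> 0"
  shows "norm (sgn y - \<eta>) \<le> 2 * norm (y - s *\<^sub>R \<eta>) / s"
proof -
  have "s * norm (sgn y - \<eta>) = norm (s *\<^sub>R sgn y - s *\<^sub>R \<eta>)"
    using assms by (simp flip: scaleR_diff_right)
  also have "\<dots> \<le> norm (s *\<^sub>R sgn y - y) + norm (y - s *\<^sub>R \<eta>)"
    using norm_triangle_ineq[of "s *\<^sub>R sgn y - y" "y - s *\<^sub>R \<eta>"] by simp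
  also have "norm (s *\<^sub>R sgn y - y) = \<bar>norm (s *\<^sub>R \<eta>) - norm y\<bar>"
  proof -
    have "norm y *\<^sub>R sgn y = y"
      using assms by (simp add: sgn_div_norm)
    then have "s *\<^sub>R sgn y - y = (s - norm y) *\<^sub>R sgn y"
      by (simp add: scaleR_left_diff_distrib)
    then show ?thesis
      using assms by (simp add: norm_sgn)
  qed
  also have "\<dots> \<le> norm (y - s *\<^sub>R \<eta>)"
    by (metis norm_minus_commute norm_triangle_ineq3)
  finally show ?thesis
    using assms by (simp add: field_simps)
qed

text \<open>
  The cone over the cap contains at least \<open>1 / \<epsilon>\<close> disjoint balls of radius \<open>\<epsilon> / 8\<close>, strung along the
  segment from \<open>\<eta> / 4\<close> to \<open>\<eta> / 2\<close>.
\<close>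
lemma measure_cap_ge:
  fixes \<eta> :: "real ^ 'n"
  assumes \<eta>: "norm \<eta> = 1" and \<epsilon>: "0 < \<epsilon>" "\<epsilon> \<le> 1"
  shows "measure sphere_measure (sphere 0 1 \<inter> cball \<eta> \<epsilon>) \<ge>
    real CARD('n) * (unit_ball_vol (real CARD('n)) / 8 ^ CARD('n)) * (\<epsilon> ^ CARD('n) / \<epsilon>)"
proof -
  define N where "N = nat \<lceil>1 / \<epsilon>\<rceil>"
  define c where "c j = (1 / 4 + real j * \<epsilon> / 4) *\<^sub>R \<eta>" for j
  define C where "C = {y \<in> ball 0 1 - {0 :: real ^ 'n}. sgn y \<in> sphere 0 1 \<inter> cball \<eta> \<epsilon>}"
  have N: "real N \<ge> 1 / \<epsilon>"
    unfolding N_def by linarith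
  have j_le: "real j * \<epsilon> \<le> 1" if "j < N" for j
  proof -
    have "int j < \<lceil>1 / \<epsilon>\<rceil>"
      using that unfolding N_def by linarith
    then have "real j < 1 / \<epsilon>"
      by (simp add: less_ceiling_iff)
    then show ?thesis
      using \<epsilon> by (simp add: field_simps)
  qed
  have sub: "ball (c j) (\<epsilon> / 8) \<subseteq> C" if "j < N" for j
  proof
    fix y assume y: "y \<in> ball (c j) (\<epsilon> / 8)"
    define s where "s = 1 / 4 + real j * \<epsilon> / 4"
    have s: "1 / 4 \<le> s" "s \<le> 1 / 2"
    proof -
      have "0 \<le> real j * \<epsilon>"
        using \<epsilon> by simp
      then show "1 / 4 \<le> s" "s \<le> 1 / 2"
        using j_le[OF that] unfolding s_def by linarith+
    qed
    have ys: "norm (y - s *\<^sub>R \<eta>) < \<epsilon> / 8"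
      using y by (simp add: c_def s_def dist_norm norm_minus_commute)
    have ns: "norm (s *\<^sub>R \<eta>) = s"
      using s \<eta> by simp
    have "norm y \<le> s + norm (y - s *\<^sub>R \<eta>)" "norm y \<ge> s - norm (y - s *\<^sub>R \<eta>)"
      using norm_triangle_sub[of y "s *\<^sub>R \<eta>"] norm_triangle_sub[of "s *\<^sub>R \<eta>" y]
      unfolding ns by (simp_all add: norm_minus_commute)
    then have ny: "norm y < 1" "norm y > 0"
      using ys s \<epsilon> by linarith+
    have "norm (sgn y - \<eta>) \<le> 2 * norm (y - s *\<^sub>R \<eta>) / s"
      using \<eta> s ny by (intro dist_sgn_ray_le) auto
    also have "\<dots> \<le> 2 * (\<epsilon> / 8) / (1 / 4)"
      using ys s \<epsilon> by (intro frac_le mult_left_mono) auto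
    finally show "y \<in> C"
      using ny by (simp add: C_def norm_sgn dist_norm norm_minus_commute)
  qed
  have disj: "disjoint_family_on (\<lambda>j. ball (c j) (\<epsilon> / 8)) {..<N}"
  proof (unfold disjoint_family_on_def, intro ballI impI)
    fix i j :: nat assume "i \<noteq> j"
    then have "1 \<le> \<bar>real i - real j\<bar>" by linarith
    then have "\<epsilon> / 4 \<le> \<bar>real i - real j\<bar> * (\<epsilon> / 4)"
      using \<epsilon> by (simp add: field_simps)
    also have "\<dots> = dist (c i) (c j)"
    proof -
      have "c i - c j = ((real i - real j) * (\<epsilon> / 4)) *\<^sub>R \<eta>"
        by (simp add: c_def algebra_simps flip: scaleR_left_diff_distrib)
      then show ?thesis
        using \<eta> \<epsilon> by (simp add: dist_norm abs_mult)
    qed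
    finally show "ball (c i) (\<epsilon> / 8) \<inter> ball (c j) (\<epsilon> / 8) = {}"
      by (intro disjoint_ballI) simp
  qed
  have cap: "sphere 0 1 \<inter> cball \<eta> \<epsilon> \<in> sets (sphere_measure :: (real ^ 'n) measure)"
    by (auto simp: sets_restrict_space)
  have C_eq: "emeasure sphere_measure (sphere 0 1 \<inter> cball \<eta> \<epsilon>) = of_nat CARD('n) * emeasure lborel C"
    unfolding C_def by (rule emeasure_sphere_measure[OF cap])
  have "C = (ball 0 1 - {0}) \<inter> (sgn -` cball \<eta> \<epsilon>)"
    by (auto simp: C_def norm_sgn)
  moreover have "(sgn :: real ^ 'n \<Rightarrow> real ^ 'n) \<in> borel_measurable borel"
    unfolding sgn_div_norm[abs_def] by measurable
  ultimately have C: "C \<in> sets borel"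
    using measurable_sets[of "sgn :: real ^ 'n \<Rightarrow> real ^ 'n" borel borel "cball \<eta> \<epsilon>"] by auto
  have fin: "emeasure lborel C \<noteq> \<infinity>"
  proof -
    have "emeasure lborel C \<le> emeasure lborel (ball (0 :: real ^ 'n) 1)"
      by (intro emeasure_mono) (auto simp: C_def)
    also have "\<dots> < \<infinity>" by (simp add: emeasure_ball)
    finally show ?thesis by simp
  qed
  have "1 / \<epsilon> * (unit_ball_vol (real CARD('n)) * (\<epsilon> / 8) ^ CARD('n)) \<le>
      real N * (unit_ball_vol (real CARD('n)) * (\<epsilon> / 8) ^ CARD('n))"
    using N \<epsilon> by (intro mult_right_mono) auto
  also have "\<dots> = (\<Sum>j<N. measure lborel (ball (c j) (\<epsilon> / 8)))"
    using \<epsilon> by (simp add: content_ball)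
  also have "\<dots> = measure lborel (\<Union>j<N. ball (c j) (\<epsilon> / 8))"
    using disj \<epsilon> by (intro measure_UNION'[symmetric]) (auto simp: disjoint_family_on_def pairwise_def disjnt_def fmeasurable_def emeasure_ball)
  also have "\<dots> \<le> measure lborel C"
    using sub C fin by (intro measure_mono_fmeasurable) (auto simp: fmeasurable_def top.not_eq_extremum less_top)
  finally have "1 / \<epsilon> * (unit_ball_vol (real CARD('n)) * (\<epsilon> / 8) ^ CARD('n)) \<le> measure lborel C" .
  then have "real CARD('n) * (1 / \<epsilon> * (unit_ball_vol (real CARD('n)) * (\<epsilon> / 8) ^ CARD('n))) \<le>
      real CARD('n) * measure lborel C"
    by (intro mult_left_mono) auto
  also have "\<dots> = measure sphere_measure (sphere 0 1 \<inter> cball \<eta> \<epsilon>)"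
    unfolding measure_def C_eq by (simp add: enn2real_mult)
  finally show ?thesis
    by (simp add: power_divide field_simps)
qed

section \<open>Estimates\<close>

lemma sin_ge_third:
  fixes u :: real
  assumes "0 \<le> u" "u \<le> pi / 2"
  shows "sin u \<ge> u / 3"
proof -
  have "u < 2"
    using assms(2) pi_half_less_two by linarith
  have "\<bar>sin u - (\<Sum>k<3. sin_coeff k * u ^ k)\<bar> \<le> inverse (fact 3) * \<bar>u\<bar> ^ 3"
    by (rule Maclaurin_sin_bound)
  moreover have "(\<Sum>k<3. sin_coeff k * u ^ k) = u"
    by (simp add: sin_coeff_def numeral_3_eq_3)
  moreover have "inverse (fact 3) * \<bar>u\<bar> ^ 3 = u * u\<^sup>2 / 6"
    using assms by (simp add: fact_numeral power2_eq_square power3_eq_cube)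
  moreover have "u * u\<^sup>2 \<le> u * 2\<^sup>2"
    using \<open>u < 2\<close> assms by (intro mult_left_mono power_mono) auto
  ultimately have "\<bar>sin u - u\<bar> \<le> u * u\<^sup>2 / 6" "u * u\<^sup>2 \<le> u * 4"
    by simp_all
  then show ?thesis
    by linarith
qed

lemma geodesic_dist_le_chord:
  assumes "norm x = 1" "norm \<eta> = 1"
  shows "geodesic_dist x \<eta> \<le> 3 * norm (x - \<eta>)"
proof -
  define \<rho> where "\<rho> = geodesic_dist x \<eta>"
  have t: "\<bar>x \<bullet> \<eta>\<bar> \<le> 1"
    using Cauchy_Schwarz_ineq2[of x \<eta>] assms by simp
  then have \<rho>: "0 \<le> \<rho>" "\<rho> \<le> pi" "cos \<rho> = x \<bullet> \<eta>"
    by (simp_all add: \<rho>_def geodesic_dist_def arccos_lbound arccos_ubound cos_arccos abs_le_iff)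
  have "(norm (x - \<eta>))\<^sup>2 = 2 - 2 * (x \<bullet> \<eta>)"
    using sphere_pole_geometry(1)[OF assms, of 1] by simp
  also have "\<dots> = (2 * sin (\<rho> / 2))\<^sup>2"
    using cos_double_sin[of "\<rho> / 2"] \<rho>(3) by (simp add: power_mult_distrib)
  finally have "norm (x - \<eta>) = 2 * sin (\<rho> / 2)"
    by (rule power2_eq_imp_eq) (use \<rho> in \<open>auto intro: sin_ge_zero\<close>)
  moreover have "sin (\<rho> / 2) \<ge> \<rho> / 2 / 3"
    using \<rho> by (intro sin_ge_third) auto
  ultimately show ?thesis
    by (simp add: \<rho>_def)
qed

lemma dist_pole_sq:
  fixes x \<eta> :: "'a :: real_inner"
  assumes "norm x = 1" "norm \<eta> = 1" "\<epsilon> > 0"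
  shows "(norm (x - (1 + \<epsilon>) *\<^sub>R \<eta>))\<^sup>2 = \<epsilon>\<^sup>2 + (1 + \<epsilon>) * (norm (x - \<eta>))\<^sup>2"
proof -
  have t: "2 * (x \<bullet> \<eta>) = 2 - (norm (x - \<eta>))\<^sup>2"
    using sphere_pole_geometry(1)[OF assms(1,2), of 1] by simp
  have "(norm (x - (1 + \<epsilon>) *\<^sub>R \<eta>))\<^sup>2 = 1 - (1 + \<epsilon>) * (2 * (x \<bullet> \<eta>)) + (1 + \<epsilon>)\<^sup>2"
    using sphere_pole_geometry(1)[OF assms(1,2), of "1 + \<epsilon>"] assms(3) by simp
  then show ?thesis
    unfolding t by (simp add: power2_eq_square algebra_simps)
qed

text \<open>
  With \<open>u = \<bar>x - \<eta>\<bar>\<close> one has \<open>\<bar>x - (1 + \<epsilon>)\<eta>\<bar>\<^sup>2 \<ge> \<epsilon>\<^sup>2 + u\<^sup>2\<close> and \<open>\<rho> \<le> 3u\<close>, hence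
  \<open>(\<epsilon> + \<rho>)\<^sup>2 \<le> 10 (\<epsilon>\<^sup>2 + u\<^sup>2)\<close> by the Cauchy-Schwarz inequality; \<open>4\<close> is a convenient bound for
  the square root of \<open>10\<close>.
\<close>
lemma dist_pole_ge:
  assumes "norm x = 1" "norm \<eta> = 1" "\<epsilon> > 0"
  shows "norm (x - (1 + \<epsilon>) *\<^sub>R \<eta>) \<ge> (\<epsilon> + geodesic_dist x \<eta>) / 4"
    and "norm (x - (1 + \<epsilon>) *\<^sub>R \<eta>) \<ge> \<epsilon>"
proof -
  define \<rho> where "\<rho> = geodesic_dist x \<eta>"
  define u where "u = norm (x - \<eta>)"
  have \<rho>: "0 \<le> \<rho>" "\<rho> \<le> 3 * u"
    using geodesic_dist_le_chord[OF assms(1,2)] Cauchy_Schwarz_ineq2[of x \<eta>] assms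
    by (simp_all add: \<rho>_def u_def geodesic_dist_def arccos_lbound abs_le_iff)
  have r: "(norm (x - (1 + \<epsilon>) *\<^sub>R \<eta>))\<^sup>2 \<ge> \<epsilon>\<^sup>2 + u\<^sup>2"
    using assms unfolding dist_pole_sq[OF assms] u_def by (simp add: algebra_simps)
  have "\<rho>\<^sup>2 \<le> (3 * u)\<^sup>2"
    using \<rho> by (intro power_mono) auto
  then have "\<rho>\<^sup>2 \<le> 9 * u\<^sup>2"
    by (simp add: power_mult_distrib)
  moreover have "18 * (\<epsilon> * \<rho>) \<le> 81 * \<epsilon>\<^sup>2 + \<rho>\<^sup>2"
    using zero_le_power2[of "9 * \<epsilon> - \<rho>"] by (simp add: power2_diff power_mult_distrib)
  moreover have "(\<epsilon> + \<rho>)\<^sup>2 = \<epsilon>\<^sup>2 + \<rho>\<^sup>2 + 2 * (\<epsilon> * \<rho>)"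
    by (simp add: power2_sum)
  ultimately have "(\<epsilon> + \<rho>)\<^sup>2 \<le> 16 * \<epsilon>\<^sup>2 + 16 * u\<^sup>2"
    using zero_le_power2[of \<epsilon>] zero_le_power2[of u] by linarith
  then have "((\<epsilon> + \<rho>) / 4)\<^sup>2 \<le> \<epsilon>\<^sup>2 + u\<^sup>2"
    by (simp add: power_divide)
  then have "((\<epsilon> + \<rho>) / 4)\<^sup>2 \<le> (norm (x - (1 + \<epsilon>) *\<^sub>R \<eta>))\<^sup>2"
    using r by linarith
  then show "norm (x - (1 + \<epsilon>) *\<^sub>R \<eta>) \<ge> (\<epsilon> + geodesic_dist x \<eta>) / 4"
    unfolding \<rho>_def by (rule power2_le_imp_le) simp
  have "\<epsilon>\<^sup>2 \<le> (norm (x - (1 + \<epsilon>) *\<^sub>R \<eta>))\<^sup>2"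
    using r zero_le_power2[of u] by linarith
  then show "norm (x - (1 + \<epsilon>) *\<^sub>R \<eta>) \<ge> \<epsilon>"
    by (rule power2_le_imp_le) simp
qed

text \<open>
  The function of \<open>t = x \<bullet> \<eta>\<close> that equals \<open>\<bar>x - (1 + \<epsilon>)\<eta>\<bar>^(-p)\<close> for unit vectors \<open>x\<close> and \<open>\<eta>\<close>.
\<close>
definition pole_profile :: "real \<Rightarrow> nat \<Rightarrow> real \<Rightarrow> real" where
  "pole_profile \<epsilon> p t = 1 / sqrt (1 - 2 * (1 + \<epsilon>) * t + (1 + \<epsilon>)\<^sup>2) ^ p"

lemma pole_profile_measurable [measurable]: "pole_profile \<epsilon> p \<in> borel_measurable borel"
  unfolding pole_profile_def[abs_def] by measurable

lemma pole_profile_inner: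
  fixes x \<eta> :: "'a :: real_inner"
  assumes "norm x = 1" "norm \<eta> = 1" "\<epsilon> > 0"
  shows "pole_profile \<epsilon> p (x \<bullet> \<eta>) = 1 / norm (x - (1 + \<epsilon>) *\<^sub>R \<eta>) ^ p"
proof -
  have "1 + \<epsilon> \<noteq> 0"
    using assms(3) by simp
  then show ?thesis
    unfolding pole_profile_def by (subst sphere_pole_geometry(1)[OF assms(1,2), symmetric]) simp_all
qed

lemma pole_profile_integral_ge:
  fixes \<eta> :: "real ^ 'n"
  assumes \<eta>: "norm \<eta> = 1" and \<epsilon>: "0 < \<epsilon>" "\<epsilon> \<le> 1"
  shows "(LINT y|sphere_measure. pole_profile \<epsilon> p (y \<bullet> \<eta>)) \<ge>
    real CARD('n) * (unit_ball_vol (real CARD('n)) / 8 ^ CARD('n)) * (\<epsilon> ^ CARD('n) / \<epsilon>) / (2 * \<epsilon>) ^ p"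
proof -
  interpret finite_measure "sphere_measure :: (real ^ 'n) measure"
    by (rule finite_measure_sphere_measure)
  define K where "K = sphere 0 1 \<inter> cball \<eta> \<epsilon>"
  have K: "K \<in> sets (sphere_measure :: (real ^ 'n) measure)"
    by (auto simp: sets_restrict_space K_def)
  have eq: "pole_profile \<epsilon> p (y \<bullet> \<eta>) = 1 / norm (y - (1 + \<epsilon>) *\<^sub>R \<eta>) ^ p"
    and r: "norm (y - (1 + \<epsilon>) *\<^sub>R \<eta>) \<ge> \<epsilon>"
    if "y \<in> sphere 0 1" for y
    using that pole_profile_inner[of y \<eta> \<epsilon> p] dist_pole_ge(2)[of y \<eta> \<epsilon>] \<eta> \<epsilon> by simp_all
  have int: "integrable sphere_measure (\<lambda>y :: real ^ 'n. pole_profile \<epsilon> p (y \<bullet> \<eta>))"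
  proof (rule integrable_const_bound[where B = "1 / \<epsilon> ^ p"])
    show "AE y in sphere_measure. norm (pole_profile \<epsilon> p (y \<bullet> \<eta>)) \<le> 1 / \<epsilon> ^ p"
    proof (rule AE_I2)
      fix y :: "real ^ 'n" assume "y \<in> space sphere_measure"
      then have y: "y \<in> sphere 0 1" by simp
      show "norm (pole_profile \<epsilon> p (y \<bullet> \<eta>)) \<le> 1 / \<epsilon> ^ p"
        using r[OF y] \<epsilon> by (simp add: eq[OF y] frac_le power_mono)
    qed
    show "(\<lambda>y. pole_profile \<epsilon> p (y \<bullet> \<eta>)) \<in> borel_measurable sphere_measure"
      by (intro measurable_sphere_measureI) measurable
  qed
  have "measure sphere_measure K / (2 * \<epsilon>) ^ p =
      (LINT y|sphere_measure. indicator K y * (1 / (2 * \<epsilon>) ^ p))"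
    using K by (simp add: Int_absorb2 K_def)
  also have "\<dots> \<le> (LINT y|sphere_measure. pole_profile \<epsilon> p (y \<bullet> \<eta>))"
  proof (rule integral_mono)
    show "integrable sphere_measure (\<lambda>y. indicator K y * (1 / (2 * \<epsilon>) ^ p) :: real)"
      using K by (intro integrable_mult_left integrable_real_indicator) (simp_all add: emeasure_finite less_top[symmetric])
    fix y :: "real ^ 'n" assume "y \<in> space sphere_measure"
    then have y: "y \<in> sphere 0 1" by simp
    show "indicator K y * (1 / (2 * \<epsilon>) ^ p) \<le> pole_profile \<epsilon> p (y \<bullet> \<eta>)"
    proof (cases "y \<in> K")
      case True
      then have "norm (y - \<eta>) \<le> \<epsilon>"
        by (simp add: K_def dist_norm norm_minus_commute)
      moreover have "norm (y - (1 + \<epsilon>) *\<^sub>R \<eta>) \<le> norm (y - \<eta>) + \<epsilon>"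
        using norm_triangle_ineq4[of "y - \<eta>" "\<epsilon> *\<^sub>R \<eta>"] \<eta> \<epsilon> by (simp add: algebra_simps)
      ultimately have "norm (y - (1 + \<epsilon>) *\<^sub>R \<eta>) ^ p \<le> (2 * \<epsilon>) ^ p"
        by (intro power_mono) auto
      moreover have "norm (y - (1 + \<epsilon>) *\<^sub>R \<eta>) ^ p > 0"
        using r[OF y] \<epsilon> by (intro zero_less_power) linarith
      ultimately show ?thesis
        using True by (simp add: eq[OF y] frac_le)
    qed (simp add: eq[OF y])
  qed (rule int)
  finally show ?thesis
    using measure_cap_ge[OF \<eta> \<epsilon>] \<epsilon> unfolding K_def
    by (meson divide_right_mono mult_nonneg_nonneg order_trans less_imp_le zero_le_numeral zero_le_power)
qed

section \<open>Localised kernels\<close>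

theorem corollary3p3:
  fixes M :: real and m :: nat
  assumes "CARD('n) \<ge> 2"
    and "M > real CARD('n) - 1"
    and "int m = \<lceil>(M - real CARD('n) + 2) / 2\<rceil>"
  shows "\<exists>c > 0. \<forall>\<epsilon> \<in> {0<..1}.
    (\<exists>b :: nat \<Rightarrow> real. \<forall>\<eta> \<in> sphere (0 :: real ^ 'n) 1. \<forall>x. x \<noteq> (1 + \<epsilon>) *\<^sub>R \<eta> \<longrightarrow>
      (CARD('n) > 2 \<longrightarrow>
        kernel_f \<epsilon> m \<eta> x = (\<Sum>l = 0..m. b l *
          (dir_deriv \<eta> ^^ l) (\<lambda>z. 1 / norm (z - (1 + \<epsilon>) *\<^sub>R \<eta>) ^ (CARD('n) - 2)) x)) \<and>
      (CARD('n) = 2 \<longrightarrow>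
        kernel_f \<epsilon> m \<eta> x = b 0 + (\<Sum>l = 1..m. b l *
          (dir_deriv \<eta> ^^ l) (\<lambda>z. ln (1 / norm (z - (1 + \<epsilon>) *\<^sub>R \<eta>))) x))) \<and>
    (\<exists>F :: real \<Rightarrow> real.
      (\<forall>\<eta> \<in> sphere (0 :: real ^ 'n) 1. \<forall>x \<in> sphere 0 1. kernel_f \<epsilon> m \<eta> x = F (x \<bullet> \<eta>)) \<and>
      (\<forall>\<eta> \<in> sphere (0 :: real ^ 'n) 1. \<forall>x \<in> sphere 0 1.
        \<bar>F (x \<bullet> \<eta>)\<bar> \<le> c * \<epsilon> powr (1 - real CARD('n)) /
          (1 + inverse \<epsilon> * geodesic_dist x \<eta>) powr M) \<and>
      (\<forall>\<eta> \<in> sphere (0 :: real ^ 'n) 1. (LINT x|sphere_measure. F (x \<bullet> \<eta>)) = 1))"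
proof -
  define d where "d = CARD('n)"
  define p where "p = 2 * m + d - 2"
  define V where "V = real d * unit_ball_vol (real d)"
  \<comment> \<open>The factor \<open>8 ^ p\<close> is \<open>4 ^ p\<close> from the lower bound of \<open>r\<close> times \<open>2 ^ p\<close> from \<open>r \<le> 2\<epsilon>\<close> on the cap;
    \<open>V / 8 ^ d\<close> is the constant in the lower bound for the measure of the cap.\<close>
  define c where "c = 8 ^ p * 8 ^ d / V"
  have d2: "d \<ge> 2"
    using assms(1) by (simp add: d_def)
  have ceil: "(M - real d + 2) / 2 \<le> real m"
    using assms(3) by (metis d_def le_of_int_ceiling of_int_of_nat_eq)
  then have m: "m \<ge> 1"
    using assms(2) by (cases "m = 0") (auto simp: d_def)
  have "real p = 2 * real m + real d - 2"
    using d2 by (simp add: p_def)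
  then have pM: "M \<le> real p"
    using ceil by simp
  have V: "V > 0"
    using d2 by (simp add: V_def)
  have c: "c > 0"
    using V by (simp add: c_def)
  obtain \<eta>0 :: "real ^ 'n" where \<eta>0: "norm \<eta>0 = 1"
    using vector_choose_size[of 1] by auto
  have "(\<exists>b :: nat \<Rightarrow> real. \<forall>\<eta> \<in> sphere (0 :: real ^ 'n) 1. \<forall>x. x \<noteq> (1 + \<epsilon>) *\<^sub>R \<eta> \<longrightarrow>
      (CARD('n) > 2 \<longrightarrow>
        kernel_f \<epsilon> m \<eta> x = (\<Sum>l = 0..m. b l *
          (dir_deriv \<eta> ^^ l) (\<lambda>z. 1 / norm (z - (1 + \<epsilon>) *\<^sub>R \<eta>) ^ (CARD('n) - 2)) x)) \<and>
      (CARD('n) = 2 \<longrightarrow>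
        kernel_f \<epsilon> m \<eta> x = b 0 + (\<Sum>l = 1..m. b l *
          (dir_deriv \<eta> ^^ l) (\<lambda>z. ln (1 / norm (z - (1 + \<epsilon>) *\<^sub>R \<eta>))) x))) \<and>
    (\<exists>F :: real \<Rightarrow> real.
      (\<forall>\<eta> \<in> sphere (0 :: real ^ 'n) 1. \<forall>x \<in> sphere 0 1. kernel_f \<epsilon> m \<eta> x = F (x \<bullet> \<eta>)) \<and>
      (\<forall>\<eta> \<in> sphere (0 :: real ^ 'n) 1. \<forall>x \<in> sphere 0 1.
        \<bar>F (x \<bullet> \<eta>)\<bar> \<le> c * \<epsilon> powr (1 - real CARD('n)) /
          (1 + inverse \<epsilon> * geodesic_dist x \<eta>) powr M) \<and>
      (\<forall>\<eta> \<in> sphere (0 :: real ^ 'n) 1. (LINT x|sphere_measure. F (x \<bullet> \<eta>)) = 1))"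
    if "\<epsilon> \<in> {0<..1}" for \<epsilon>
  proof -
    have \<epsilon>: "0 < \<epsilon>" "\<epsilon> \<le> 1"
      using that by auto
    define a where "a = 1 + \<epsilon>"
    define \<delta> where "\<delta> = 1 - 1 / a\<^sup>2"
    define q where "q = coeffs d \<delta> m"
    \<comment> \<open>On the sphere, \<open>H\<close> is \<open>K\<close> times the profile, whose integral is \<open>J\<close> for every \<open>\<eta>\<close>; the vector \<open>\<eta>0\<close> only
      serves to define \<open>J\<close> without reference to \<open>\<eta>\<close>.\<close>
    define K where "K = potential_fps (real d / 2 - 1) 1 $ m * (a * \<delta>) ^ (2 * m) / \<delta>"
    define J where "J = (LINT y|sphere_measure. pole_profile \<epsilon> p (y \<bullet> \<eta>0))"
    define W where "W = inverse (K * J)"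
    have J: "(LINT y|sphere_measure. pole_profile \<epsilon> p (y \<bullet> \<eta>)) = J" if "norm \<eta> = 1" for \<eta> :: "real ^ 'n"
      unfolding J_def using that \<eta>0 by (intro zonal_integral_eq) simp_all
    have J_ge: "J \<ge> V / 8 ^ d * (\<epsilon> ^ d / \<epsilon>) / (2 * \<epsilon>) ^ p"
      using pole_profile_integral_ge[OF \<eta>0 \<epsilon>, of p] by (simp add: J_def V_def d_def)
    moreover have J_low: "V / 8 ^ d * (\<epsilon> ^ d / \<epsilon>) / (2 * \<epsilon>) ^ p > 0"
      using V \<epsilon> by simp
    ultimately have J0: "J > 0"
      by linarith
    have "\<delta> > 0" "a * \<delta> > 0"
      using pole_parameters_pos(1,2)[OF \<eta>0 \<eta>0 \<epsilon>(1)] by (simp_all add: \<delta>_def a_def)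
    moreover have "potential_fps (real d / 2 - 1) 1 $ m > 0"
      using m d2 by (simp add: potential_fps_def pochhammer_pos)
    ultimately have K0: "K > 0"
      by (simp add: K_def)
    have H: "kernel_H \<epsilon> m \<eta> x = K * pole_profile \<epsilon> p (x \<bullet> \<eta>)"
      if "norm \<eta> = 1" "norm x = 1" for x \<eta> :: "real ^ 'n"
      using kernel_H_on_sphere[OF that(2,1) \<epsilon>(1) assms(1) m] pole_profile_inner[OF that(2,1) \<epsilon>(1)]
      by (simp add: K_def \<delta>_def a_def d_def p_def)
    have int_H: "(LINT y|sphere_measure. kernel_H \<epsilon> m \<eta> y) = K * J"
      if "norm \<eta> = 1" for \<eta> :: "real ^ 'n"
    proof -
      have "(LINT y|sphere_measure. kernel_H \<epsilon> m \<eta> y) =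
          (LINT y|sphere_measure. K * pole_profile \<epsilon> p (y \<bullet> \<eta>))"
        using that by (intro Bochner_Integration.integral_cong) (simp_all add: H)
      then show ?thesis
        using J[OF that] by simp
    qed
    have f: "kernel_f \<epsilon> m \<eta> x = kernel_H \<epsilon> m \<eta> x * W" if "norm \<eta> = 1" for x \<eta> :: "real ^ 'n"
      by (simp add: kernel_f_def int_H[OF that] W_def)
    define F where "F t = pole_profile \<epsilon> p t / J" for t
    have F_eq: "kernel_f \<epsilon> m \<eta> x = F (x \<bullet> \<eta>)"
      if "norm \<eta> = 1" "norm x = 1" for x \<eta> :: "real ^ 'n"
      using K0 J0 by (simp add: f[OF that(1)] H[OF that] F_def W_def field_simps)
    have F_int: "(LINT x|sphere_measure. F (x \<bullet> \<eta>)) = 1" if "norm \<eta> = 1" for \<eta> :: "real ^ 'n"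
      using J[OF that] J0 by (simp add: F_def)
    have F_bound: "\<bar>F (x \<bullet> \<eta>)\<bar> \<le> c * \<epsilon> powr (1 - real d) / (1 + inverse \<epsilon> * geodesic_dist x \<eta>) powr M"
      if "norm \<eta> = 1" "norm x = 1" for x \<eta> :: "real ^ 'n"
    proof -
      define \<rho> where "\<rho> = geodesic_dist x \<eta>"
      define r where "r = norm (x - (1 + \<epsilon>) *\<^sub>R \<eta>)"
      define u where "u = 1 + inverse \<epsilon> * \<rho>"
      have "\<rho> \<ge> 0"
        using Cauchy_Schwarz_ineq2[of x \<eta>] that
        by (simp add: \<rho>_def geodesic_dist_def arccos_lbound abs_le_iff)
      then have u: "u \<ge> 1"
        using \<epsilon> by (simp add: u_def)
      have "\<epsilon> * u = \<epsilon> + \<rho>"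
        using \<epsilon> by (simp add: u_def field_simps)
      then have "r \<ge> \<epsilon> * u / 4"
        using dist_pole_ge(1)[OF that(2,1) \<epsilon>(1)] by (simp add: r_def \<rho>_def)
      then have rp: "r ^ p \<ge> (\<epsilon> * u / 4) ^ p"
        using \<epsilon> u by (intro power_mono) auto
      have "u powr M \<le> u ^ p"
        using powr_mono[OF pM u] u by (simp add: powr_realpow)
      then have up: "1 / u ^ p \<le> 1 / u powr M"
        using u by (intro divide_left_mono) auto
      have "\<bar>F (x \<bullet> \<eta>)\<bar> = 1 / r ^ p / J"
        using J0 pole_profile_inner[OF that(2,1) \<epsilon>(1), of p] by (simp add: F_def r_def)
      also have "\<dots> \<le> 1 / (\<epsilon> * u / 4) ^ p / (V / 8 ^ d * (\<epsilon> ^ d / \<epsilon>) / (2 * \<epsilon>) ^ p)"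
        using rp J_ge J_low \<epsilon> u by (intro frac_le) auto
      also have "\<dots> = c * (\<epsilon> / \<epsilon> ^ d) * (1 / u ^ p)"
      proof -
        have "(8 :: real) ^ p = 4 ^ p * 2 ^ p"
          by (simp flip: power_mult_distrib)
        then show ?thesis
          using \<epsilon> u V by (simp add: c_def power_divide power_mult_distrib field_simps)
      qed
      also have "\<dots> \<le> c * (\<epsilon> / \<epsilon> ^ d) * (1 / u powr M)"
        using up c \<epsilon> by (intro mult_left_mono) auto
      also have "\<epsilon> / \<epsilon> ^ d = \<epsilon> powr (1 - real d)"
        using \<epsilon> by (simp add: powr_diff powr_realpow)
      finally show ?thesis
        by (simp add: u_def \<rho>_def)
    qed
    define b where "b l = (if l = 0 then q 0
      else q l * \<delta> ^ (l - 1) * a ^ l / (fact l * (if d = 2 then 1 else real d - 2))) * W" for l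
    have b_expansion: "(d > 2 \<longrightarrow>
        kernel_f \<epsilon> m \<eta> x = (\<Sum>l = 0..m. b l *
          (dir_deriv \<eta> ^^ l) (\<lambda>z. 1 / norm (z - a *\<^sub>R \<eta>) ^ (d - 2)) x)) \<and>
      (d = 2 \<longrightarrow>
        kernel_f \<epsilon> m \<eta> x = b 0 + (\<Sum>l = 1..m. b l *
          (dir_deriv \<eta> ^^ l) (\<lambda>z. ln (1 / norm (z - a *\<^sub>R \<eta>))) x))"
      if "norm \<eta> = 1" for x \<eta> :: "real ^ 'n"
    proof (intro conjI impI)
      assume "d > 2"
      have "2 - int d = - int (d - 2)"
        using d2 by simp
      then have powi: "norm z powi (2 - int d) = 1 / norm z ^ (d - 2)" for z :: "real ^ 'n"
        by (simp only: power_int_minus power_int_of_nat inverse_eq_divide)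
      have "kernel_H \<epsilon> m \<eta> x = q 0 * (1 / norm (x - a *\<^sub>R \<eta>) ^ (d - 2)) +
        (\<Sum>l = 1..m. q l * \<delta> ^ (l - 1) * a ^ l / (fact l * (real d - 2)) *
          (dir_deriv \<eta> ^^ l) (\<lambda>z. 1 / norm (z - a *\<^sub>R \<eta>) ^ (d - 2)) x)"
        using \<open>d > 2\<close> unfolding powi[symmetric]
        by (simp add: kernel_H_def Let_def d_def q_def \<delta>_def a_def)
      then show "kernel_f \<epsilon> m \<eta> x = (\<Sum>l = 0..m. b l *
          (dir_deriv \<eta> ^^ l) (\<lambda>z. 1 / norm (z - a *\<^sub>R \<eta>) ^ (d - 2)) x)"
        using \<open>d > 2\<close> unfolding f[OF that]
        by (simp add: sum.atLeast_Suc_atMost b_def sum_distrib_left distrib_left mult.commute[of _ W] mult.assoc)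
    next
      assume "d = 2"
      then have "kernel_H \<epsilon> m \<eta> x = q 0 + (\<Sum>l = 1..m. q l * \<delta> ^ (l - 1) * a ^ l / fact l *
          (dir_deriv \<eta> ^^ l) (\<lambda>z. ln (1 / norm (z - a *\<^sub>R \<eta>))) x)"
        by (simp add: kernel_H_def Let_def d_def q_def \<delta>_def a_def)
      then show "kernel_f \<epsilon> m \<eta> x = b 0 + (\<Sum>l = 1..m. b l *
          (dir_deriv \<eta> ^^ l) (\<lambda>z. ln (1 / norm (z - a *\<^sub>R \<eta>))) x)"
        using \<open>d = 2\<close> unfolding f[OF that]
        by (simp add: b_def sum_distrib_left distrib_left mult.commute[of _ W] mult.assoc)
    qed
    show ?thesis
    proof (intro conjI exI[of _ b] exI[of _ F] ballI allI impI)
    qed (use b_expansion F_eq F_int F_bound in \<open>simp_all add: d_def a_def\<close>)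
  qed
  then show ?thesis
    using c by blast
qed

end
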